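(* Let $(M,d)$ be a complete metric space with base point $0$, and let $\mu\in\mathcal{M}(\beta\widetilde{M})$ be positive and concentrated on $\mathsf{R}^+$. Then $\mu\in\mathcal{M}_{\mathrm{op}}(\beta\widetilde{M})$ if and only if $\mu$ is concentrated on a set $C\subset\mathsf{R}^+\cap\mathsf{O}$ such that $\mathfrak{p}(C)\subset M^{\mathcal{R}}\times M^{\mathcal{R}}$ is $\bar{d}$-cyclically monotonic.
   Context: Basic spaces. $(M,d)$ is a complete metric space with base point $0\in M$. $\mathrm{Lip}_0(M)$ is the Banach space of real-valued Lipschitz functions $f$ on $M$ with $f(0)=0$, normed by the optimal Lipschitz constant $\|f\|_L$. $\widetilde{M}=\{(x,y)\in M\times M: x\neq y\}$ and $\beta\widetilde{M}$ is its Stone-Čech compactification. For a Hausdorff space $X$, $\mathcal{M}(X)$ is the Banach space (total variation norm) of signed Radon measures on $X$ (Borel, countably additive, regular, tight, finite). A measure is "concentrated on $C$" if $C$ is measurable for it and the complement of $C$ is null. $\Phi:\mathrm{Lip}_0(M)\to C(\beta\widetilde{M})$ is the linear isometric embedding given by $(\Phi f)(x,y)=\frac{f(x)-f(y)}{d(x,y)}$ on $\widetilde{M}$, extended continuously to $\beta\widetilde{M}$; $\Phi^*:\mathcal{M}(\beta\widetilde{M})\to\mathrm{Lip}_0(M)^*$ is its adjoint. $\mathcal{M}_{\mathrm{op}}(\beta\widetilde{M})=\{\mu\in\mathcal{M}(\beta\widetilde{M}):\mu\geq 0,\ \|\mu\|=\|\Phi^*\mu\|\}$. $\delta_\zeta$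 denotes the Dirac measure at $\zeta\in\beta\widetilde{M}$. Compactifications. $M^{\mathcal{U}}$ is the uniform (Samuel) compactification of $M$: the unique compactification to which every bounded uniformly continuous $f:M\to\mathbb{R}$ extends continuously and in which the closures of $A,B\subset M$ are disjoint iff $d(A,B)>0$. Every Lipschitz $f:M\to\mathbb{R}$ extends uniquely and continuously to $f^{\mathcal{U}}:M^{\mathcal{U}}\to[-\infty,\infty]$. With $\rho(x)=d(x,0)$, let $M^{\mathcal{R}}=\{\xi\in M^{\mathcal{U}}:\rho^{\mathcal{U}}(\xi)<\infty\}$ (the Lipschitz realcompactification), with the subspace topology $\tau$, and $f^{\mathcal{R}}=f^{\mathcal{U}}|_{M^{\mathcal{R}}}$ (real-valued). For $\xi\in M^{\mathcal{R}}$, $\delta(\xi)\in\mathrm{Lip}_0(M)^*$ is $\langle f,\delta(\xi)\rangle=f^{\mathcal{R}}(\xi)$, and $\bar{d}(\xi,\eta)=\|\delta(\xi)-\delta(\eta)\|_{\mathrm{Lip}_0(M)^*}$, a metric on $M^{\mathcal{R}}$ extending $d$. Coordinates. $\mathfrak{p}_i:\beta\widetilde{M}\to M^{\mathcal{U}}$ ($i=1,2$) is the continuous extension of the $i$-th coordinate projection on $\widetilde{M}$, and $\mathfrak{p}=(\mathfrak{p}_1,\mathfrak{p}_2):\beta\widetilde{M}\to M^{\mathcal{U}}\times M^{\mathcal{U}}$. $\mathsf{R}^+=\{\zeta\in\beta\widetilde{M}:\mathfrak{p}_1(\zeta),\mathfrak{p}_2(\zeta)\in M^{\mathcal{R}},\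 \mathfrak{p}_1(\zeta)\neq\mathfrak{p}_2(\zeta)\}$. $\mathsf{O}=\{\zeta\in\beta\widetilde{M}:\|\Phi^*\delta_\zeta\|=1\}$ is the set of optimal points. For a metric $d$ on a set $X$, $C\subset X\times X$ is $d$-cyclically monotonic if for all $(x_1,y_1),\dots,(x_n,y_n)\in C$ and every permutation $\sigma$ of $\{1,\dots,n\}$, $\sum_{k=1}^n d(x_k,y_k)\leq\sum_{k=1}^n d(x_k,y_{\sigma(k)})$. *)

theory Defs
  imports "HOL-Probability.Probability"
begin

section \<open>Compactifications\<close>

text \<open>For a family \<open>F\<close> of bounded continuous functions on \<open>S\<close>, the compactification of \<open>S\<close>
  generated by \<open>F\<close> is the closure of the image of \<open>S\<close> under the evaluation map into the
  product of \<open>F\<close> many real lines.\<close>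

definition eval_emb :: "('x \<Rightarrow> real) set \<Rightarrow> 'x \<Rightarrow> ('x \<Rightarrow> real) \<Rightarrow> real" where
  "eval_emb F x = restrict (\<lambda>h. h x) F"

definition eval_closure :: "'x set \<Rightarrow> ('x \<Rightarrow> real) set \<Rightarrow> (('x \<Rightarrow> real) \<Rightarrow> real) topology" where
  "eval_closure S F =
     subtopology (product_topology (\<lambda>_. euclideanreal) F)
       (product_topology (\<lambda>_. euclideanreal) F closure_of (eval_emb F ` S))"

definition bounded_cont :: "'x::topological_space set \<Rightarrow> ('x \<Rightarrow> real) set" where
  "bounded_cont S = {h. continuous_on S h \<and> bounded (h ` S)}"

definition bounded_ucont :: "('x::metric_space \<Rightarrow> real) set" where
  "bounded_ucont = {h. uniformly_continuous_on UNIV h \<and> bounded (range h)}"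

definition stone_cech :: "'x::topological_space set \<Rightarrow> (('x \<Rightarrow> real) \<Rightarrow> real) topology" where
  "stone_cech S = eval_closure S (bounded_cont S)"

definition samuel :: "(('x::metric_space \<Rightarrow> real) \<Rightarrow> real) topology" where
  "samuel = eval_closure UNIV bounded_ucont"

text \<open>The continuous extension to \<open>K\<close>, with values in \<open>Y\<close>, of a function \<open>f\<close> on \<open>S\<close>, where
  \<open>S\<close> is regarded as a dense subset of \<open>K\<close> by means of \<open>e\<close>. Extensionality makes it unique
  as a total function.\<close>

definition cont_ext ::
  "'k topology \<Rightarrow> ('x \<Rightarrow> 'k) \<Rightarrow> 'x set \<Rightarrow> 'y topology \<Rightarrow> ('x \<Rightarrow> 'y) \<Rightarrow> 'k \<Rightarrow> 'y" where
  "cont_ext K e S Y f =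
     (THE g. g \<in> extensional (topspace K) \<and> continuous_map K Y g \<and> (\<forall>x\<in>S. g (e x) = f x))"


section \<open>Radon measures\<close>

definition borel_alg :: "'k topology \<Rightarrow> 'k measure" where
  "borel_alg X = sigma (topspace X) {U. openin X U}"

text \<open>The positive elements of the space of signed Radon measures on \<open>X\<close>.\<close>

definition radon_pos :: "'k topology \<Rightarrow> 'k measure set" where
  "radon_pos X = {\<mu>. sets \<mu> = sets (borel_alg X) \<and> finite_measure \<mu> \<and>
     (\<forall>A\<in>sets \<mu>. \<forall>e>0. \<exists>C. closedin X C \<and> C \<subseteq> A \<and> measure \<mu> (A - C) < e) \<and>
     (\<forall>e>0. \<exists>K\<in>sets \<mu>. compactin X K \<and> measure \<mu> (space \<mu> - K) < e)}"

definition total_variation :: "'k measure \<Rightarrow> real" where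
  "total_variation \<mu> =
     (SUP P \<in> {P. finite P \<and> disjoint P \<and> P \<subseteq> sets \<mu>}. \<Sum>A\<in>P. \<bar>measure \<mu> A\<bar>)"

text \<open>Measurability of \<open>C\<close> is with respect to \<open>\<mu>\<close>, so \<open>C\<close> need not be a Borel set; hence the
  completion.\<close>

definition concentrated_on :: "'k measure \<Rightarrow> 'k set \<Rightarrow> bool" where
  "concentrated_on \<mu> C \<longleftrightarrow>
     C \<in> sets (completion \<mu>) \<and> emeasure (completion \<mu>) (space \<mu> - C) = 0"


section \<open>Lipschitz functions and their dual\<close>

definition Lip0 :: "'a::metric_space \<Rightarrow> ('a \<Rightarrow> real) set" where
  "Lip0 z = {f. f z = 0 \<and> (\<exists>L. L-lipschitz_on UNIV f)}"

definition lip_norm :: "('a::metric_space \<Rightarrow> real) \<Rightarrow> real" where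
  "lip_norm f = Inf {L. L-lipschitz_on UNIV f}"

text \<open>Functionals on \<open>Lip0 z\<close> are functions on all of \<open>'a \<Rightarrow> real\<close>, of which only the values on
  \<open>Lip0 z\<close> matter.\<close>

definition dual_norm :: "'a::metric_space \<Rightarrow> (('a \<Rightarrow> real) \<Rightarrow> real) \<Rightarrow> real" where
  "dual_norm z \<phi> = (SUP f \<in> {f \<in> Lip0 z. lip_norm f \<le> 1}. \<bar>\<phi> f\<bar>)"


section \<open>The De Leeuw transform\<close>

definition offdiag :: "('a \<times> 'a) set" where
  "offdiag = {(x, y). x \<noteq> y}"

type_synonym 'a dl_point = "('a \<times> 'a \<Rightarrow> real) \<Rightarrow> real"
type_synonym 'a u_point = "('a \<Rightarrow> real) \<Rightarrow> real"

definition beta_offdiag :: "'a::metric_space dl_point topology" where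
  "beta_offdiag = stone_cech offdiag"

definition emb_offdiag :: "'a::metric_space \<times> 'a \<Rightarrow> 'a dl_point" where
  "emb_offdiag = eval_emb (bounded_cont offdiag)"

definition emb_samuel :: "'a::metric_space \<Rightarrow> 'a u_point" where
  "emb_samuel = eval_emb bounded_ucont"

definition de_leeuw :: "('a::metric_space \<Rightarrow> real) \<Rightarrow> 'a dl_point \<Rightarrow> real" where
  "de_leeuw f = cont_ext beta_offdiag emb_offdiag offdiag euclideanreal
     (\<lambda>(x, y). (f x - f y) / dist x y)"

definition de_leeuw_adj :: "'a::metric_space dl_point measure \<Rightarrow> ('a \<Rightarrow> real) \<Rightarrow> real" where
  "de_leeuw_adj \<mu> f = (\<integral>\<zeta>. de_leeuw f \<zeta> \<partial>\<mu>)"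

definition M_op :: "'a::metric_space \<Rightarrow> 'a dl_point measure set" where
  "M_op z = {\<mu> \<in> radon_pos beta_offdiag. total_variation \<mu> = dual_norm z (de_leeuw_adj \<mu>)}"

definition optimal_points :: "'a::metric_space \<Rightarrow> 'a dl_point set" where
  "optimal_points z = {\<zeta> \<in> topspace beta_offdiag.
     dual_norm z (de_leeuw_adj (return (borel_alg beta_offdiag) \<zeta>)) = 1}"


section \<open>The Lipschitz realcompactification\<close>

definition ext_U :: "('a::metric_space \<Rightarrow> real) \<Rightarrow> 'a u_point \<Rightarrow> ereal" where
  "ext_U f = cont_ext samuel emb_samuel UNIV euclidean (\<lambda>x. ereal (f x))"

definition M_R :: "'a::metric_space \<Rightarrow> 'a u_point set" where
  "M_R z = {\<xi> \<in> topspace samuel. ext_U (\<lambda>x. dist x z) \<xi> < \<infinity>}"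

definition delta_R :: "'a::metric_space u_point \<Rightarrow> ('a \<Rightarrow> real) \<Rightarrow> real" where
  "delta_R \<xi> f = real_of_ereal (ext_U f \<xi>)"

definition dist_R :: "'a::metric_space \<Rightarrow> 'a u_point \<Rightarrow> 'a u_point \<Rightarrow> real" where
  "dist_R z \<xi> \<eta> = dual_norm z (\<lambda>f. delta_R \<xi> f - delta_R \<eta> f)"

definition proj1 :: "'a::metric_space dl_point \<Rightarrow> 'a u_point" where
  "proj1 = cont_ext beta_offdiag emb_offdiag offdiag samuel (\<lambda>(x, y). emb_samuel x)"

definition proj2 :: "'a::metric_space dl_point \<Rightarrow> 'a u_point" where
  "proj2 = cont_ext beta_offdiag emb_offdiag offdiag samuel (\<lambda>(x, y). emb_samuel y)"

definition proj :: "'a::metric_space dl_point \<Rightarrow> 'a u_point \<times> 'a u_point" where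
  "proj \<zeta> = (proj1 \<zeta>, proj2 \<zeta>)"

definition R_plus :: "'a::metric_space \<Rightarrow> 'a dl_point set" where
  "R_plus z = {\<zeta> \<in> topspace beta_offdiag.
     proj1 \<zeta> \<in> M_R z \<and> proj2 \<zeta> \<in> M_R z \<and> proj1 \<zeta> \<noteq> proj2 \<zeta>}"

definition cyclically_monotonic :: "('x \<Rightarrow> 'x \<Rightarrow> real) \<Rightarrow> ('x \<times> 'x) set \<Rightarrow> bool" where
  "cyclically_monotonic d C \<longleftrightarrow>
     (\<forall>(n::nat) x y \<sigma>. (\<forall>k\<in>{1..n}. (x k, y k) \<in> C) \<longrightarrow> \<sigma> permutes {1..n} \<longrightarrow>
        (\<Sum>k=1..n. d (x k) (y k)) \<le> (\<Sum>k=1..n. d (x k) (y (\<sigma> k))))"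


section \<open>Characteristic properties of the compactifications\<close>

lemma topspace_eval_closure:
  "topspace (eval_closure S F) = product_topology (\<lambda>_. euclideanreal) F closure_of (eval_emb F ` S)"
  unfolding eval_closure_def topspace_subtopology
  by (rule Int_absorb1[OF closure_of_subset_topspace])

lemma Hausdorff_eval_closure: "Hausdorff_space (eval_closure S F)"
  unfolding eval_closure_def
  by (intro Hausdorff_space_subtopology) (auto simp: Hausdorff_space_product_topology)

lemma eval_emb_in: "eval_emb F ` S \<subseteq> topspace (product_topology (\<lambda>_. euclideanreal) F)"
  by (auto simp: eval_emb_def)

lemma eval_emb_topspace: "x \<in> S \<Longrightarrow> eval_emb F x \<in> topspace (eval_closure S F)"
  unfolding topspace_eval_closure using closure_of_subset[OF eval_emb_in[of F S]] by auto

lemma dense_eval_closure: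
  "eval_closure S F closure_of (eval_emb F ` S) = topspace (eval_closure S F)"
proof -
  let ?P = "product_topology (\<lambda>_. euclideanreal) F"
  have sub: "eval_emb F ` S \<subseteq> ?P closure_of (eval_emb F ` S)"
    by (rule closure_of_subset[OF eval_emb_in])
  show ?thesis
    unfolding topspace_eval_closure unfolding eval_closure_def
    using sub by (simp only: closure_of_subtopology_open[OF disjI2] Int_absorb)
qed

lemma compact_eval_closure:
  assumes "\<And>h. h \<in> F \<Longrightarrow> bounded (h ` S)"
  shows "compact_space (eval_closure S F)"
proof -
  let ?P = "product_topology (\<lambda>_. euclideanreal) F"
  have "\<exists>B. \<forall>x\<in>S. \<bar>h x\<bar> \<le> B" if "h \<in> F" for h
    using assms[OF that] by (auto simp: bounded_iff)
  then obtain B where B: "\<And>h x. h \<in> F \<Longrightarrow> x \<in> S \<Longrightarrow> \<bar>h x\<bar> \<le> B h"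
    by metis
  let ?K = "PiE F (\<lambda>h. {- B h..B h})"
  have K: "compactin ?P ?K"
    by (auto simp: compactin_PiE)
  have Kcl: "closedin ?P ?K"
    by (auto simp: closedin_product_topology)
  have "eval_emb F ` S \<subseteq> ?K"
    using B by (fastforce simp: eval_emb_def abs_le_iff)
  then have "?P closure_of (eval_emb F ` S) \<subseteq> ?K"
    by (rule closure_of_minimal[OF _ Kcl])
  then have "compactin ?P (?P closure_of (eval_emb F ` S))"
    using closed_compactin[OF K] by auto
  then show ?thesis
    unfolding eval_closure_def by (simp add: compact_space_subtopology)
qed

lemma continuous_map_eval:
  "h \<in> F \<Longrightarrow> continuous_map (eval_closure S F) euclideanreal (\<lambda>\<xi>. \<xi> h)"
  unfolding eval_closure_def
  by (intro continuous_map_from_subtopology continuous_map_product_projection)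

lemma embedding_map_eval_emb:
  fixes S :: "'x::topological_space set"
  assumes cont: "\<And>h. h \<in> F \<Longrightarrow> continuous_on S h"
    and sep: "\<And>U a. open U \<Longrightarrow> a \<in> U \<Longrightarrow> a \<in> S \<Longrightarrow> \<exists>h\<in>F. \<exists>c. h a < c \<and> (\<forall>x\<in>S - U. c \<le> h x)"
    and inj: "inj_on (eval_emb F) S"
  shows "embedding_map (top_of_set S) (eval_closure S F) (eval_emb F)"
proof -
  let ?K = "eval_closure S F"
  let ?e = "eval_emb F"
  have c: "continuous_map (top_of_set S) ?K ?e"
    unfolding eval_closure_def
    using closure_of_subset[OF eval_emb_in[of F S]]
    by (auto simp: continuous_map_in_subtopology continuous_map_componentwise eval_emb_def cont)
  have "open_map (top_of_set S) (subtopology ?K (?e ` S)) ?e"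
    unfolding open_map_def
  proof (intro allI impI)
    fix V assume V: "openin (top_of_set S) V"
    then obtain U where U: "open U" "V = S \<inter> U" by (auto simp: openin_open)
    show "openin (subtopology ?K (?e ` S)) (?e ` V)"
    proof (subst openin_subopen, intro ballI)
      fix \<xi> assume "\<xi> \<in> ?e ` V"
      then obtain a where a: "a \<in> S" "a \<in> U" "\<xi> = ?e a" using U by auto
      then obtain h r where h: "h \<in> F" "h a < r" "\<And>x. x \<in> S - U \<Longrightarrow> r \<le> h x"
        using sep[OF U(1)] by blast
      let ?T = "{\<eta> \<in> topspace ?K. \<eta> h \<in> {..<r}}"
      have "openin ?K ?T"
        using continuous_map_eval[OF h(1), of S] by (rule openin_continuous_map_preimage) auto
      then have "openin (subtopology ?K (?e ` S)) (?T \<inter> ?e ` S)"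
        by (rule openin_subtopology_Int)
      moreover have "\<xi> \<in> ?T \<inter> ?e ` S"
        using a h eval_emb_topspace[of a S F] by (auto simp: eval_emb_def)
      moreover have "?T \<inter> ?e ` S \<subseteq> ?e ` V"
        using h U by (force simp: eval_emb_def)
      ultimately show "\<exists>T. openin (subtopology ?K (?e ` S)) T \<and> \<xi> \<in> T \<and> T \<subseteq> ?e ` V"
        by blast
    qed
  qed
  moreover have "topspace (subtopology ?K (?e ` S)) = ?e ` S"
    using eval_emb_topspace[of _ S F] by (auto simp: topspace_subtopology)
  moreover have "continuous_map (top_of_set S) (subtopology ?K (?e ` S)) ?e"
    using c by (auto intro: continuous_map_into_subtopology)
  ultimately show ?thesis
    unfolding embedding_map_def using inj
    by (intro bijective_open_imp_homeomorphic_map) (simp_all del: topspace_subtopology)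
qed

lemma min_dist_ucont: "(\<lambda>x::'x::metric_space. min e (dist x a)) \<in> bounded_ucont" if "0 \<le> e"
proof -
  have "uniformly_continuous_on UNIV (\<lambda>x::'x. min e (dist x a))"
  proof (rule lipschitz_on_uniformly_continuous[where L = 1], rule lipschitz_onI)
    fix x y :: 'x
    show "dist (min e (dist x a)) (min e (dist y a)) \<le> 1 * dist x y"
      using dist_triangle[of x a y] dist_triangle[of y a x] by (auto simp: dist_real_def dist_commute min_def)
  qed simp
  moreover have "bounded (range (\<lambda>x. min e (dist x a)))"
    using that by (auto simp: bounded_iff intro!: exI[of _ e])
  ultimately show ?thesis by (simp add: bounded_ucont_def)
qed

lemma bounded_ucont_subset: "bounded_ucont \<subseteq> bounded_cont S"
  by (auto simp: bounded_ucont_def bounded_cont_def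
      intro: continuous_on_subset[OF uniformly_continuous_imp_continuous] bounded_subset)

lemma embedding_map_metric:
  fixes S :: "'x::metric_space set"
  assumes "bounded_ucont \<subseteq> F" "F \<subseteq> bounded_cont S"
  shows "embedding_map (top_of_set S) (eval_closure S F) (eval_emb F)"
proof (rule embedding_map_eval_emb)
  show "continuous_on S h" if "h \<in> F" for h
    using that assms by (auto simp: bounded_cont_def)
  show "\<exists>h\<in>F. \<exists>c. h a < c \<and> (\<forall>x\<in>S - U. c \<le> h x)" if "open U" "a \<in> U" "a \<in> S" for U a
  proof -
    obtain e where e: "e > 0" "ball a e \<subseteq> U"
      using \<open>open U\<close> \<open>a \<in> U\<close> by (meson open_contains_ball)
    have "(\<lambda>x. min e (dist x a)) \<in> F" using min_dist_ucont[of e a] e assms by auto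
    moreover have "\<forall>x\<in>S - U. e \<le> min e (dist x a)"
      using e by (auto simp: subset_iff dist_commute not_less[symmetric])
    ultimately show ?thesis using e(1) by (intro bexI[of _ "\<lambda>x. min e (dist x a)"] exI[of _ e]) auto
  qed
  show "inj_on (eval_emb F) S"
  proof (rule inj_onI)
    fix x y assume "eval_emb F x = eval_emb F y"
    moreover have "(\<lambda>u. min 1 (dist u y)) \<in> F" using min_dist_ucont[of 1 y] assms by auto
    ultimately have "min 1 (dist x y) = min 1 (dist y y)"
      unfolding eval_emb_def by (metis (mono_tags, lifting) restrict_apply')
    then show "x = y" by (auto simp: min_def split: if_splits)
  qed
qed

lemma stone_cech_compactification:
  fixes S :: "'x::metric_space set"
  shows "compact_space (stone_cech S)" "Hausdorff_space (stone_cech S)"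
    "embedding_map (top_of_set S) (stone_cech S) (eval_emb (bounded_cont S))"
    "stone_cech S closure_of (eval_emb (bounded_cont S) ` S) = topspace (stone_cech S)"
  unfolding stone_cech_def
     apply (rule compact_eval_closure, simp add: bounded_cont_def)
    apply (rule Hausdorff_eval_closure)
   apply (rule embedding_map_metric[OF bounded_ucont_subset order_refl])
  apply (rule dense_eval_closure)
  done

lemma samuel_compactification:
  "compact_space (samuel :: ('x::metric_space u_point) topology)"
  "Hausdorff_space (samuel :: ('x u_point) topology)"
  "embedding_map euclidean (samuel :: ('x u_point) topology) emb_samuel"
  "samuel closure_of (range emb_samuel) = topspace (samuel :: ('x u_point) topology)"
  unfolding samuel_def emb_samuel_def
     apply (rule compact_eval_closure, simp add: bounded_ucont_def)
    apply (rule Hausdorff_eval_closure)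
   apply (rule embedding_map_metric[OF order_refl bounded_ucont_subset, of UNIV, simplified])
  apply (rule dense_eval_closure)
  done

lemma cont_ext_eqI:
  assumes dense: "K closure_of (e ` S) = topspace K" and Y: "Hausdorff_space Y"
    and g: "continuous_map K Y g" "\<And>x. x \<in> S \<Longrightarrow> g (e x) = f x"
    and e: "e ` S \<subseteq> topspace K"
  shows "cont_ext K e S Y f = restrict g (topspace K)"
  unfolding cont_ext_def
proof (rule the_equality)
  show "restrict g (topspace K) \<in> extensional (topspace K) \<and>
      continuous_map K Y (restrict g (topspace K)) \<and>
      (\<forall>x\<in>S. restrict g (topspace K) (e x) = f x)"
    using g e continuous_map_eq[OF g(1), of "restrict g (topspace K)"] by auto
next
  fix k assume k: "k \<in> extensional (topspace K) \<and> continuous_map K Y k \<and> (\<forall>x\<in>S. k (e x) = f x)"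
  show "k = restrict g (topspace K)"
  proof
    fix \<xi> show "k \<xi> = restrict g (topspace K) \<xi>"
    proof (cases "\<xi> \<in> topspace K")
      case True
      have "k \<xi> = g \<xi>"
      proof (rule forall_in_closure_of_eq[of \<xi> K "e ` S" Y])
        show "k x = g x" if "x \<in> e ` S" for x
          using that g(2) k by auto
      qed (use True dense Y g(1) k in auto)
      then show ?thesis using True by simp
    next
      case False
      then show ?thesis using k by (auto simp: extensional_def)
    qed
  qed
qed

lemma cont_ext_eval:
  assumes "h \<in> F" "\<xi> \<in> topspace (eval_closure S F)"
  shows "cont_ext (eval_closure S F) (eval_emb F) S euclideanreal h \<xi> = \<xi> h"
  using cont_ext_eqI[OF dense_eval_closure Hausdorff_space_euclidean continuous_map_eval[OF assms(1)], of S h]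
    assms eval_emb_topspace[of _ S F]
  by (auto simp: eval_emb_def image_subset_iff)

lemma openin_product_topology_finite:
  assumes "openin (product_topology (\<lambda>_. euclideanreal) F) T" "\<xi> \<in> T"
  shows "\<exists>H r. finite H \<and> H \<subseteq> F \<and> 0 < r \<and>
    (\<forall>\<eta>\<in>extensional F. (\<forall>h\<in>H. \<bar>\<eta> h - \<xi> h\<bar> < r) \<longrightarrow> \<eta> \<in> T)"
proof -
  obtain U where U: "finite {i \<in> F. U i \<noteq> UNIV}" "\<And>i. i \<in> F \<Longrightarrow> open (U i)"
    "\<xi> \<in> PiE F U" "PiE F U \<subseteq> T"
    using assms unfolding openin_product_topology_alt by auto
  let ?H = "{i \<in> F. U i \<noteq> UNIV}"
  have "\<exists>r>0. ball (\<xi> h) r \<subseteq> U h" if "h \<in> F" for h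
    using U(2)[OF that] U(3) that by (auto simp: open_contains_ball PiE_iff)
  then obtain r where r: "\<And>h. h \<in> F \<Longrightarrow> 0 < r h \<and> ball (\<xi> h) (r h) \<subseteq> U h"
    by metis
  define m where "m = Min (insert 1 (r ` ?H))"
  have m: "0 < m" "\<And>h. h \<in> ?H \<Longrightarrow> m \<le> r h"
    unfolding m_def using U(1) r by auto
  have "\<eta> \<in> T" if "\<eta> \<in> extensional F" and close: "\<forall>h\<in>?H. \<bar>\<eta> h - \<xi> h\<bar> < m" for \<eta>
  proof -
    have "\<eta> h \<in> U h" if "h \<in> F" for h
    proof (cases "h \<in> ?H")
      case True
      then have "\<eta> h \<in> ball (\<xi> h) (r h)"
        using close m(2)[OF True] by (fastforce simp: dist_real_def abs_minus_commute)
      then show ?thesis using r[OF that] by auto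
    qed (use that in auto)
    then have "\<eta> \<in> PiE F U" using that by (auto simp: PiE_iff)
    then show ?thesis using U(4) by auto
  qed
  then show ?thesis using U(1) m(1) by (intro exI[of _ ?H] exI[of _ m]) auto
qed

lemma samuel_disjoint_closures:
  fixes A B :: "'x::metric_space set"
  shows "disjnt (samuel closure_of (emb_samuel ` A)) (samuel closure_of (emb_samuel ` B)) \<longleftrightarrow>
    (\<exists>r>0. \<forall>a\<in>A. \<forall>b\<in>B. r \<le> dist a b)"
    (is "disjnt ?A ?B \<longleftrightarrow> ?R")
proof
  assume ?R
  then obtain r where r: "r > 0" "\<And>a b. a \<in> A \<Longrightarrow> b \<in> B \<Longrightarrow> r \<le> dist a b" by auto
  show "disjnt ?A ?B"
  proof (cases "A = {}")
    case False
    let ?h = "\<lambda>x. min r (infdist x A)"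
    have "uniformly_continuous_on UNIV ?h"
    proof (rule lipschitz_on_uniformly_continuous[where L = 1], rule lipschitz_onI)
      fix x y
      show "dist (?h x) (?h y) \<le> 1 * dist x y"
        using infdist_triangle_abs[of x A y] by (auto simp: dist_real_def min_def)
    qed simp
    moreover have "bounded (range ?h)"
      using r(1) infdist_nonneg[of _ A] by (auto simp: bounded_iff intro!: exI[of _ r])
    ultimately have h: "?h \<in> bounded_ucont" by (simp add: bounded_ucont_def)
    have cont: "continuous_map samuel euclideanreal (\<lambda>\<xi>. \<xi> ?h)"
      unfolding samuel_def by (rule continuous_map_eval[OF h])
    have eval: "emb_samuel x ?h = ?h x" for x
      using h by (simp add: emb_samuel_def eval_emb_def)
    have "\<xi> ?h = 0" if "\<xi> \<in> ?A" for \<xi>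
      using r(1)
      by (intro forall_in_closure_of_eq[OF that Hausdorff_space_euclidean cont, of "\<lambda>_. 0"])
        (auto simp: eval)
    moreover have "\<xi> ?h = r" if "\<xi> \<in> ?B" for \<xi>
    proof (rule forall_in_closure_of_eq[OF that Hausdorff_space_euclidean cont, of "\<lambda>_. r"])
      fix \<eta> assume "\<eta> \<in> emb_samuel ` B"
      then obtain b where b: "b \<in> B" "\<eta> = emb_samuel b" by auto
      have "r \<le> infdist b A"
        unfolding infdist_notempty[OF False]
        using r(2) b(1) False by (intro cINF_greatest) (auto simp: dist_commute)
      then show "\<eta> ?h = r" using b eval by simp
    qed simp
    ultimately show ?thesis using r(1) unfolding disjnt_iff by force
  qed auto
next
  assume disj: "disjnt ?A ?B"
  show ?R
  proof (rule ccontr)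
    assume "\<not> ?R"
    then have near: "\<exists>a\<in>A. \<exists>b\<in>B. dist a b < r" if "r > 0" for r
      using that by (meson not_le)
    define A' where "A' n = {a \<in> A. \<exists>b\<in>B. dist a b < 1 / real (Suc n)}" for n
    have "(\<Inter>n. samuel closure_of (emb_samuel ` A' n)) \<noteq> {}"
    proof (rule compact_space_imp_nest[OF samuel_compactification(1)])
      show "samuel closure_of (emb_samuel ` A' n) \<noteq> {}" for n
      proof -
        have "A' n \<noteq> {}" using near[of "1 / real (Suc n)"] by (auto simp: A'_def)
        moreover have "emb_samuel ` A' n \<subseteq> topspace samuel"
          unfolding samuel_def emb_samuel_def by (auto intro: eval_emb_topspace)
        ultimately show ?thesis
          using closure_of_subset[of "emb_samuel ` A' n" samuel] by (metis image_is_empty subset_empty)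
      qed
      show "decseq (\<lambda>n. samuel closure_of (emb_samuel ` A' n))"
      proof (rule decseq_SucI, rule closure_of_mono, rule image_mono)
        fix n
        have "1 / real (Suc (Suc n)) \<le> 1 / real (Suc n)"
          by (simp add: frac_le)
        then show "A' (Suc n) \<subseteq> A' n" unfolding A'_def using less_le_trans by blast
      qed
    qed simp
    then obtain \<xi> where \<xi>: "\<And>n. \<xi> \<in> samuel closure_of (emb_samuel ` A' n)" by auto
    have "\<xi> \<in> ?A"
      using \<xi>[of 0] closure_of_mono[of "emb_samuel ` A' 0" "emb_samuel ` A" samuel]
      by (auto simp: A'_def)
    moreover have "\<xi> \<in> ?B"
      unfolding in_closure_of
    proof (intro conjI allI impI)
      show \<xi>K: "\<xi> \<in> topspace samuel" using \<xi>[of 0] by (simp add: in_closure_of)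
      fix T assume "\<xi> \<in> T \<and> openin samuel T"
      then obtain T' where T': "\<xi> \<in> T'" "T = T' \<inter> topspace samuel"
        "openin (product_topology (\<lambda>_. euclideanreal) bounded_ucont) T'"
        unfolding samuel_def topspace_eval_closure
        unfolding eval_closure_def openin_subtopology by auto
      from openin_product_topology_finite[OF T'(3,1)]
      obtain H r where H: "finite H" "H \<subseteq> bounded_ucont" "0 < r"
        and HT: "\<forall>\<eta>\<in>extensional bounded_ucont. (\<forall>h\<in>H. \<bar>\<eta> h - \<xi> h\<bar> < r) \<longrightarrow> \<eta> \<in> T'"
        by (elim exE conjE)
      have "\<exists>s>0. \<forall>x y. dist x y < s \<longrightarrow> \<bar>h x - h y\<bar> < r / 2" if "h \<in> H" for h
      proof -
        have "uniformly_continuous_on UNIV h" using that H(2) by (auto simp: bounded_ucont_def)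
        then obtain s where "s > 0" "\<And>x y. dist y x < s \<Longrightarrow> dist (h y) (h x) < r / 2"
          using H(3) unfolding uniformly_continuous_on_def by (meson UNIV_I half_gt_zero)
        then show ?thesis unfolding dist_real_def by blast
      qed
      then obtain s where s: "\<And>h. h \<in> H \<Longrightarrow> 0 < s h"
        "\<And>h x y. h \<in> H \<Longrightarrow> dist x y < s h \<Longrightarrow> \<bar>h x - h y\<bar> < r / 2"
        by metis
      define m where "m = Min (insert 1 (s ` H))"
      have m: "0 < m" "\<And>h. h \<in> H \<Longrightarrow> m \<le> s h"
        unfolding m_def using H(1) s(1) by auto
      obtain n where n: "1 / real (Suc n) < m"
        using nat_approx_posE[OF m(1)] by blast
      let ?V = "{\<eta> \<in> topspace samuel. \<forall>h\<in>H. \<eta> h \<in> ball (\<xi> h) (r / 2)}"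
      have "openin samuel ?V"
      proof -
        have "openin samuel {\<eta> \<in> topspace samuel. \<eta> h \<in> ball (\<xi> h) (r / 2)}" if "h \<in> H" for h
          using that H(2) unfolding samuel_def
          by (intro openin_continuous_map_preimage[OF continuous_map_eval]) auto
        then have "openin samuel (topspace samuel \<inter>
            (\<Inter>h\<in>H. {\<eta> \<in> topspace samuel. \<eta> h \<in> ball (\<xi> h) (r / 2)}))"
          using H(1) by (intro openin_Int_Inter) auto
        then show ?thesis by (rule back_subst) auto
      qed
      moreover have "\<xi> \<in> ?V" using \<xi>K H(3) by auto
      ultimately have "\<exists>y. y \<in> emb_samuel ` A' n \<and> y \<in> ?V"
        using \<xi>[of n] unfolding in_closure_of by (elim conjE allE[of _ ?V] impE) auto
      then obtain a where a: "a \<in> A' n" "emb_samuel a \<in> ?V" by (elim exE conjE imageE) simp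
      then obtain b where b: "b \<in> B" "dist a b < 1 / real (Suc n)" by (auto simp: A'_def)
      have "emb_samuel b \<in> T'"
      proof (rule HT[rule_format])
        show "emb_samuel b \<in> extensional bounded_ucont" by (simp add: emb_samuel_def eval_emb_def)
        fix h assume h: "h \<in> H"
        have "\<bar>h a - h b\<bar> < r / 2" using s(2)[OF h] m(2)[OF h] n b(2) by auto
        moreover have "\<bar>\<xi> h - h a\<bar> < r / 2"
          using a(2) h H(2) by (auto simp: emb_samuel_def eval_emb_def dist_real_def subset_iff)
        moreover have "emb_samuel b h = h b"
          using h H(2) by (auto simp: emb_samuel_def eval_emb_def)
        ultimately show "\<bar>emb_samuel b h - \<xi> h\<bar> < r" by (smt (verit) field_sum_of_halves)
      qed
      moreover have "emb_samuel b \<in> topspace samuel"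
        unfolding samuel_def emb_samuel_def by (rule eval_emb_topspace) simp
      ultimately show "\<exists>y. y \<in> emb_samuel ` B \<and> y \<in> T" using b(1) T'(2) by auto
    qed
    ultimately show False using disj by (auto simp: disjnt_iff)
  qed
qed

lemma total_variation_eq:
  assumes "finite_measure \<mu>"
  shows "total_variation \<mu> = measure \<mu> (space \<mu>)"
proof -
  interpret finite_measure \<mu> by fact
  have le: "(\<Sum>A\<in>P. \<bar>measure \<mu> A\<bar>) \<le> measure \<mu> (space \<mu>)"
    if "finite P" "disjoint P" "P \<subseteq> sets \<mu>" for P
  proof -
    have "(\<Sum>A\<in>P. \<bar>measure \<mu> A\<bar>) = measure \<mu> (\<Union>A\<in>P. A)"
      using that by (subst finite_measure_finite_Union) (auto simp: disjoint_family_on_def disjoint_def)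
    also have "\<dots> \<le> measure \<mu> (space \<mu>)" by (rule bounded_measure)
    finally show ?thesis .
  qed
  show ?thesis
    unfolding total_variation_def
  proof (rule cSup_eq_maximum)
    show "measure \<mu> (space \<mu>) \<in> (\<lambda>P. \<Sum>A\<in>P. \<bar>measure \<mu> A\<bar>) `
        {P. finite P \<and> disjoint P \<and> P \<subseteq> sets \<mu>}"
      by (rule image_eqI[of _ _ "{space \<mu>}"]) (auto simp: disjoint_def)
  qed (use le in auto)
qed

end

theory Submission
  imports Defs
begin

text \<open>On \<open>R_plus z\<close> the metric extends to a positive real function \<open>gap\<close> with
  \<open>\<Phi> f \<zeta> * gap \<zeta> = f (p\<^sub>1 \<zeta>) - f (p\<^sub>2 \<zeta>)\<close>, and \<open>\<zeta>\<close> is optimal iff \<open>gap \<zeta>\<close> is the distance of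
  its coordinates. If \<open>\<mu>\<close> is optimal, then \<open>\<Phi> f\<^sub>n \<rightarrow> 1\<close> almost everywhere for suitable \<open>f\<^sub>n\<close> in the
  unit ball, and telescoping the differences of \<open>f\<^sub>n\<close> yields cyclic monotonicity.

  Conversely, one may restrict to a compact \<open>K \<subseteq> C\<close>. Rockafellar's potential of \<open>K\<close> attains the
  distance on all of \<open>K\<close>, but need not be continuous for the compact topology. Its
  truncation to chains of length at most \<open>n\<close>, however, is a supremum of extended Lipschitz functions: this
  is inherited from \<open>n\<close> to \<open>Suc n\<close> by compactness of \<open>K\<close>, because finite minima of Lipschitz
  functions are Lipschitz. Regularity of \<open>\<mu>\<close> then makes one Lipschitz function close to such a
  truncation outside a set of small measure, so no duality theorem is needed.\<close>

section \<open>Limits along a point of a compactification\<close>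

text \<open>Replaces nets in \<open>S\<close> converging to \<open>\<xi>\<close>: limits along this
  filter compute continuous extensions at \<open>\<xi>\<close>, so identities and inequalities on
  \<open>S\<close> pass to the compactification.\<close>

definition trace_filter :: "'x set \<Rightarrow> ('x \<Rightarrow> real) set \<Rightarrow> (('x \<Rightarrow> real) \<Rightarrow> real) \<Rightarrow> 'x filter" where
  "trace_filter S F \<xi> =
     inf (filtercomap (eval_emb F) (nhdsin (eval_closure S F) \<xi>)) (principal S)"

lemma eventually_trace_filter_in: "\<forall>\<^sub>F x in trace_filter S F \<xi>. x \<in> S"
  by (simp add: trace_filter_def eventually_inf_principal)

text \<open>Density of the image of \<open>S\<close> makes the filter proper, as uniqueness of
  limits and limits of inequalities require.\<close>

lemma trace_filter_neq_bot:
  assumes "\<xi> \<in> topspace (eval_closure S F)"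
  shows "trace_filter S F \<xi> \<noteq> bot"
proof
  assume "trace_filter S F \<xi> = bot"
  then have "eventually (\<lambda>_. False) (trace_filter S F \<xi>)" by simp
  then obtain U where U: "openin (eval_closure S F) U" "\<xi> \<in> U" "\<And>x. x \<in> S \<Longrightarrow> eval_emb F x \<notin> U"
    using assms by (auto simp: trace_filter_def eventually_inf_principal eventually_filtercomap eventually_nhdsin)
  have "\<xi> \<in> eval_closure S F closure_of (eval_emb F ` S)"
    using assms by (simp add: dense_eval_closure)
  then show False using U unfolding in_closure_of by blast
qed

lemma tendsto_trace_filter:
  assumes "\<xi> \<in> topspace (eval_closure S F)" "h \<in> F"
  shows "(h \<longlongrightarrow> \<xi> h) (trace_filter S F \<xi>)"
proof (rule topological_tendstoI)
  fix U :: "real set" assume U: "open U" "\<xi> h \<in> U"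
  have "openin (eval_closure S F) {\<eta> \<in> topspace (eval_closure S F). \<eta> h \<in> U}"
    using continuous_map_eval[OF assms(2)] U(1) by (intro openin_continuous_map_preimage) auto
  moreover have "\<eta> h \<in> U \<Longrightarrow> \<forall>x\<in>S. eval_emb F x = \<eta> \<longrightarrow> h x \<in> U" for \<eta>
    using assms(2) by (auto simp: eval_emb_def)
  ultimately show "\<forall>\<^sub>F x in trace_filter S F \<xi>. h x \<in> U"
    using assms U(2)
    unfolding trace_filter_def eventually_inf_principal eventually_filtercomap eventually_nhdsin
    by (intro exI[of _ "\<lambda>\<eta>. \<eta> h \<in> U"]) (auto simp: eval_emb_def)
qed

text \<open>The generating families contain bounded functions only, so an unbounded \<open>u\<close>
  enters through \<open>arctan\<close>. An eventual bound on \<open>u\<close> keeps the limit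
  strictly inside the interval on which \<open>tan\<close> is continuous and undoes
  \<open>arctan\<close>.\<close>

lemma tendsto_tan_trace_filter:
  assumes "\<xi> \<in> topspace (eval_closure S F)" "(\<lambda>x. arctan (u x)) \<in> F"
    and "\<forall>\<^sub>F x in trace_filter S F \<xi>. \<bar>u x\<bar> \<le> B"
  shows "\<bar>\<xi> (\<lambda>x. arctan (u x))\<bar> < pi / 2"
    and "(u \<longlongrightarrow> tan (\<xi> (\<lambda>x. arctan (u x)))) (trace_filter S F \<xi>)"
proof -
  let ?t = "\<xi> (\<lambda>x. arctan (u x))"
  note lim = tendsto_trace_filter[OF assms(1,2)]
  note nb = trace_filter_neq_bot[OF assms(1)]
  have "?t \<le> arctan B"
    by (rule tendsto_upperbound[OF lim _ nb])
      (use assms(3) in \<open>auto elim!: eventually_mono simp: abs_le_iff arctan_le_iff\<close>)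
  moreover have "- arctan B \<le> ?t"
    by (rule tendsto_lowerbound[OF lim _ nb])
      (use assms(3) in \<open>auto elim!: eventually_mono simp: abs_le_iff arctan_minus[symmetric] arctan_le_iff simp del: arctan_minus\<close>)
  ultimately show t: "\<bar>?t\<bar> < pi / 2" using arctan_ubound[of B] by linarith
  then have "cos ?t \<noteq> 0" using cos_gt_zero_pi[of ?t] by linarith
  from isCont_tendsto_compose[OF isCont_tan[OF this] lim] show "(u \<longlongrightarrow> tan ?t) (trace_filter S F \<xi>)"
    by (simp add: tan_arctan)
qed


section \<open>Extending Lipschitz functions to the uniform compactification\<close>

text \<open>Inverse of \<open>arctan\<close> continued to the closed interval by infinite end
  values, to match the extended real values of \<open>ext_U\<close>.\<close>

definition tan_ereal :: "real \<Rightarrow> ereal" where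
  "tan_ereal t = (if t \<ge> pi / 2 then \<infinity> else if t \<le> - pi / 2 then - \<infinity> else ereal (tan t))"

lemma continuous_tan_ereal: "continuous_on {- pi / 2..pi / 2} tan_ereal"
  unfolding continuous_on_def
proof
  fix t assume t: "t \<in> {- pi / 2..pi / 2}"
  let ?I = "{- pi / 2..pi / 2}"
  consider "t = pi / 2" | "t = - pi / 2" | "- pi / 2 < t" "t < pi / 2" using t by fastforce
  then show "(tan_ereal \<longlongrightarrow> tan_ereal t) (at t within ?I)"
  proof cases
    case 1
    have "((\<lambda>x. ereal (tan x)) \<longlongrightarrow> \<infinity>) (at_left (pi / 2))"
      using filterlim_tan_at_left by (simp add: tendsto_PInfty' filterlim_at_top_dense tendsto_PInfty)
    moreover have "\<forall>\<^sub>F x in at_left (pi / 2). ereal (tan x) = tan_ereal x"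
      unfolding eventually_at_left_field
      by (intro exI[of _ 0]) (auto simp: tan_ereal_def)
    ultimately have "(tan_ereal \<longlongrightarrow> \<infinity>) (at_left (pi / 2))"
      by (rule Lim_transform_eventually)
    moreover have "at t within ?I = at_left (pi / 2)"
      unfolding 1 by (rule at_within_Icc_at_left) simp
    ultimately show ?thesis unfolding 1 by (simp add: tan_ereal_def)
  next
    case 2
    have "((\<lambda>x. ereal (tan x)) \<longlongrightarrow> - \<infinity>) (at_right (- pi / 2))"
      using filterlim_tan_at_right by (simp add: filterlim_at_bot_dense tendsto_MInfty)
    moreover have "\<forall>\<^sub>F x in at_right (- pi / 2). ereal (tan x) = tan_ereal x"
      unfolding eventually_at_right_field
      by (intro exI[of _ 0]) (auto simp: tan_ereal_def)
    ultimately have "(tan_ereal \<longlongrightarrow> - \<infinity>) (at_right (- pi / 2))"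
      by (rule Lim_transform_eventually)
    moreover have "at t within ?I = at_right (- pi / 2)"
      unfolding 2 by (rule at_within_Icc_at_right) simp
    ultimately show ?thesis unfolding 2 by (simp add: tan_ereal_def pi_gt_zero[THEN not_le[THEN iffD2]])
  next
    case 3
    have "((\<lambda>x. ereal (tan x)) \<longlongrightarrow> ereal (tan t)) (at t)"
      using 3 cos_gt_zero_pi[of t] by (intro tendsto_intros tendsto_ereal) auto
    moreover have "\<forall>\<^sub>F x in at t. ereal (tan x) = tan_ereal x"
      by (rule eventually_at_in_open'[of "{- pi / 2<..<pi / 2}", THEN eventually_mono])
        (use 3 in \<open>auto simp: tan_ereal_def\<close>)
    ultimately have "(tan_ereal \<longlongrightarrow> ereal (tan t)) (at t)"
      by (rule Lim_transform_eventually)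
    then have "(tan_ereal \<longlongrightarrow> ereal (tan t)) (at t within ?I)"
      by (rule tendsto_within_subset) simp
    then show ?thesis using 3 by (simp add: tan_ereal_def)
  qed
qed

lemma arctan_lipschitz: "\<bar>arctan x - arctan y\<bar> \<le> \<bar>x - y\<bar>"
proof -
  have "norm (arctan x - arctan y) \<le> 1 * norm (x - y)"
    by (rule field_differentiable_bound[of UNIV arctan "\<lambda>x. inverse (1 + x\<^sup>2)"])
      (auto intro!: DERIV_arctan[THEN has_field_derivative_at_within] inverse_le_1_iff[THEN iffD2])
  then show ?thesis by simp
qed

lemma abs_arctan_less: "\<bar>arctan x\<bar> < pi / 2"
  using arctan_bounded[of x] by linarith

text \<open>Makes \<open>arctan\<close> of an unbounded Lipschitz function an admissible coordinate
  of the points of \<open>samuel\<close>.\<close>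

lemma arctan_lipschitz_ucont:
  assumes "L-lipschitz_on UNIV (f :: 'a::metric_space \<Rightarrow> real)"
  shows "(\<lambda>x. arctan (f x)) \<in> bounded_ucont"
proof -
  have "L-lipschitz_on UNIV (\<lambda>x. arctan (f x))"
    using assms unfolding lipschitz_on_def dist_real_def
    by (meson arctan_lipschitz order_trans)
  moreover have "bounded (range (\<lambda>x. arctan (f x)))"
    unfolding bounded_iff
    by (rule exI[of _ "pi / 2"]) (use abs_arctan_less in \<open>auto intro: less_imp_le\<close>)
  ultimately show ?thesis
    by (auto simp: bounded_ucont_def intro: lipschitz_on_uniformly_continuous)
qed

text \<open>Resolves the definite description in \<open>cont_ext\<close>: the right-hand side is
  continuous in \<open>\<xi>\<close> and agrees with \<open>f\<close> on the dense image of the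
  space.\<close>

lemma ext_U_eq:
  assumes f: "L-lipschitz_on UNIV (f :: 'a::metric_space \<Rightarrow> real)" and \<xi>: "\<xi> \<in> topspace samuel"
  shows "ext_U f \<xi> = tan_ereal (\<xi> (\<lambda>x. arctan (f x)))"
proof -
  let ?h = "\<lambda>x. arctan (f x)"
  let ?I = "{- pi / 2..pi / 2}"
  note h = arctan_lipschitz_ucont[OF f]
  have top: "topspace samuel = topspace (eval_closure UNIV (bounded_ucont :: ('a \<Rightarrow> real) set))"
    by (simp add: samuel_def)
  have "\<eta> ?h \<in> ?I" if "\<eta> \<in> topspace samuel" for \<eta>
  proof -
    have T: "(?h \<longlongrightarrow> \<eta> ?h) (trace_filter UNIV bounded_ucont \<eta>)"
      "trace_filter UNIV bounded_ucont \<eta> \<noteq> bot"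
      using tendsto_trace_filter trace_filter_neq_bot that h unfolding top by blast+
    have b: "- (pi / 2) \<le> ?h x" "?h x \<le> pi / 2" for x
      using arctan_ubound[of "f x"] arctan_lbound[of "f x"] by linarith+
    show ?thesis
      using tendsto_upperbound[OF T(1) _ T(2), of "pi / 2"] tendsto_lowerbound[OF T(1) _ T(2), of "- (pi / 2)"] b
      by auto
  qed
  then have "continuous_map samuel (top_of_set ?I) (\<lambda>\<eta>. \<eta> ?h)"
    using continuous_map_eval[OF h, of UNIV]
    by (auto simp: samuel_def continuous_map_in_subtopology)
  then have "continuous_map samuel euclidean (\<lambda>\<eta>. tan_ereal (\<eta> ?h))"
    using continuous_map_compose[of samuel "top_of_set ?I" "\<lambda>\<eta>. \<eta> ?h" euclidean tan_ereal]
      continuous_tan_ereal by (simp add: o_def)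
  then have "ext_U f = restrict (\<lambda>\<eta>. tan_ereal (\<eta> ?h)) (topspace samuel)"
    unfolding ext_U_def
  proof (rule cont_ext_eqI[rotated 2])
    show "tan_ereal (emb_samuel x ?h) = ereal (f x)" for x
      using h arctan_bounded[of "f x"] by (simp add: emb_samuel_def eval_emb_def tan_ereal_def tan_arctan)
    show "range emb_samuel \<subseteq> topspace (samuel :: 'a u_point topology)"
      by (auto simp: top emb_samuel_def eval_emb_topspace)
    show "Hausdorff_space (euclidean :: ereal topology)"
      using hausdorff by (auto simp: Hausdorff_space_def disjnt_def)
  qed (use samuel_compactification(4) in auto)
  then show ?thesis using \<xi> by simp
qed

section \<open>Finite values at points of the realcompactification\<close>

lemma dist_lipschitz: "1-lipschitz_on UNIV (\<lambda>x. dist x (z :: 'a::metric_space))"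
  by (rule lipschitz_onI) (auto simp: dist_real_def abs_le_iff algebra_simps dist_triangle dist_triangle3)

abbreviation tr_U :: "'a::metric_space u_point \<Rightarrow> 'a filter" where
  "tr_U \<equiv> trace_filter UNIV bounded_ucont"

lemma tr_U_neq_bot: "\<xi> \<in> M_R z \<Longrightarrow> tr_U \<xi> \<noteq> bot"
  by (rule trace_filter_neq_bot) (simp add: M_R_def samuel_def)

text \<open>Finiteness of the extended distance to \<open>z\<close> bounds \<open>dist x z\<close>
  near \<open>\<xi>\<close>, and a Lipschitz function grows at most linearly in that
  distance.\<close>

lemma M_R_eventually_bounded:
  fixes f :: "'a::metric_space \<Rightarrow> real"
  assumes "\<xi> \<in> M_R z" "L-lipschitz_on UNIV f"
  shows "\<exists>B. \<forall>\<^sub>F x in tr_U \<xi>. \<bar>f x\<bar> \<le> B"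
proof -
  let ?h = "\<lambda>x. arctan (dist x z)"
  have \<xi>: "\<xi> \<in> topspace (eval_closure UNIV bounded_ucont)" using assms by (simp add: M_R_def samuel_def)
  note h = arctan_lipschitz_ucont[OF dist_lipschitz[of z]]
  note lim = tendsto_trace_filter[OF \<xi> h]
  have "tan_ereal (\<xi> ?h) < \<infinity>"
    using assms(1) ext_U_eq[OF dist_lipschitz[of z]] by (auto simp: M_R_def)
  then have "\<xi> ?h < pi / 2" by (auto simp: tan_ereal_def split: if_splits)
  \<comment> \<open>Room below \<open>pi / 2\<close> makes \<open>tan c\<close> a finite bound for
    the distance to \<open>z\<close>.\<close>
  then obtain c where c: "\<xi> ?h < c" "c < pi / 2" by (blast dest: dense)
  have "\<forall>\<^sub>F x in tr_U \<xi>. ?h x < c" by (rule order_tendstoD(2)[OF lim c(1)])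
  then have "\<forall>\<^sub>F x in tr_U \<xi>. \<bar>f x\<bar> \<le> \<bar>f z\<bar> + L * tan c"
  proof eventually_elim
    case (elim x)
    then have "tan (?h x) \<le> tan c"
      using tan_monotone[of "?h x" c] arctan_lbound[of "dist x z"] c by (simp add: less_imp_le)
    then have "dist x z \<le> tan c" by (simp add: tan_arctan)
    moreover have "\<bar>f x - f z\<bar> \<le> L * dist x z" "0 \<le> L"
      using assms(2) unfolding lipschitz_on_def dist_real_def by auto
    ultimately show ?case using mult_left_mono[of "dist x z" "tan c" L] by linarith
  qed
  then show ?thesis ..
qed

lemma delta_R_eq:
  assumes "\<xi> \<in> M_R z" "L-lipschitz_on UNIV f"
  shows "delta_R \<xi> f = tan (\<xi> (\<lambda>x. arctan (f x)))" "\<bar>\<xi> (\<lambda>x. arctan (f x))\<bar> < pi / 2"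
proof -
  obtain B where B: "\<forall>\<^sub>F x in tr_U \<xi>. \<bar>f x\<bar> \<le> B" using M_R_eventually_bounded[OF assms] by blast
  have \<xi>: "\<xi> \<in> topspace (eval_closure UNIV bounded_ucont)" "\<xi> \<in> topspace samuel"
    using assms by (simp_all add: M_R_def samuel_def)
  show b: "\<bar>\<xi> (\<lambda>x. arctan (f x))\<bar> < pi / 2"
    by (rule tendsto_tan_trace_filter(1)[OF \<xi>(1) arctan_lipschitz_ucont[OF assms(2)] B])
  then show "delta_R \<xi> f = tan (\<xi> (\<lambda>x. arctan (f x)))"
    unfolding delta_R_def ext_U_eq[OF assms(2) \<xi>(2)] by (auto simp: tan_ereal_def)
qed

lemma delta_R_tendsto:
  assumes "\<xi> \<in> M_R z" "L-lipschitz_on UNIV f"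
  shows "(f \<longlongrightarrow> delta_R \<xi> f) (tr_U \<xi>)"
proof -
  obtain B where B: "\<forall>\<^sub>F x in tr_U \<xi>. \<bar>f x\<bar> \<le> B" using M_R_eventually_bounded[OF assms] by blast
  show ?thesis unfolding delta_R_eq(1)[OF assms]
    by (rule tendsto_tan_trace_filter(2)[OF _ arctan_lipschitz_ucont[OF assms(2)] B])
      (use assms in \<open>simp add: M_R_def samuel_def\<close>)
qed

lemma delta_R_eqI:
  assumes "\<xi> \<in> M_R z" "L-lipschitz_on UNIV f" "(f \<longlongrightarrow> c) (tr_U \<xi>)"
  shows "delta_R \<xi> f = c"
  by (rule tendsto_unique[OF tr_U_neq_bot[OF assms(1)] delta_R_tendsto[OF assms(1,2)] assms(3)])

text \<open>Two points differ at some bounded uniformly continuous \<open>h\<close>. The distance to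
  a sublevel set of \<open>h\<close> vanishes near the point with the smaller value and, by uniform
  continuity, stays above some \<open>r > 0\<close> near the other.\<close>

lemma delta_R_separates:
  assumes "\<xi> \<in> M_R z" "\<eta> \<in> M_R z" "\<xi> \<noteq> \<eta>"
  shows "\<exists>f. 1-lipschitz_on UNIV f \<and> delta_R \<xi> f \<noteq> delta_R \<eta> f"
proof -
  have *: "\<exists>f. 1-lipschitz_on UNIV f \<and> delta_R \<xi> f \<noteq> delta_R \<eta> f"
    if \<xi>: "\<xi> \<in> M_R z" and \<eta>: "\<eta> \<in> M_R z" and h: "h \<in> bounded_ucont" "\<xi> h < \<eta> h" for \<xi> \<eta> h
  proof -
    obtain a where a: "\<xi> h < a" "a < \<eta> h" using dense[OF h(2)] by blast
    obtain b where b: "a < b" "b < \<eta> h" using dense[OF a(2)] by blast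
    have top: "\<xi> \<in> topspace (eval_closure UNIV bounded_ucont)" "\<eta> \<in> topspace (eval_closure UNIV bounded_ucont)"
      using \<xi> \<eta> by (simp_all add: M_R_def samuel_def)
    let ?A = "{x. h x < a}" and ?f = "\<lambda>x. infdist x {x. h x < a}"
    have f: "1-lipschitz_on UNIV ?f"
      by (rule lipschitz_onI) (auto simp: dist_real_def infdist_triangle_abs)
    have A: "\<forall>\<^sub>F x in tr_U \<xi>. x \<in> ?A"
      using order_tendstoD(2)[OF tendsto_trace_filter[OF top(1) h(1)] a(1)] by simp
    then have "\<forall>\<^sub>F x in tr_U \<xi>. ?f x = 0" by eventually_elim simp
    then have "delta_R \<xi> ?f = 0"
      by (intro delta_R_eqI[OF \<xi> f] tendsto_eventually)
    have ne: "?A \<noteq> {}" using eventually_happens'[OF tr_U_neq_bot[OF \<xi>] A] by blast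
    have "uniformly_continuous_on UNIV h" using h(1) by (simp add: bounded_ucont_def)
    then obtain r where r: "r > 0" "\<And>x y. dist y x < r \<Longrightarrow> dist (h y) (h x) < b - a"
      using b unfolding uniformly_continuous_on_def by (metis UNIV_I diff_gt_0_iff_gt)
    have "\<forall>\<^sub>F x in tr_U \<eta>. b < h x"
      by (rule order_tendstoD(1)[OF tendsto_trace_filter[OF top(2) h(1)] b(2)])
    then have "\<forall>\<^sub>F x in tr_U \<eta>. r \<le> ?f x"
    proof eventually_elim
      case (elim x)
      have "r \<le> dist x y" if "y \<in> ?A" for y
        using r(2)[of x y] elim that by (fastforce simp: dist_real_def)
      then show ?case unfolding infdist_notempty[OF ne] using ne by (intro cINF_greatest) auto
    qed
    then have "r \<le> delta_R \<eta> ?f"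
      by (rule tendsto_lowerbound[OF delta_R_tendsto[OF \<eta> f] _ tr_U_neq_bot[OF \<eta>]])
    then show ?thesis using \<open>delta_R \<xi> ?f = 0\<close> r(1) f by (intro exI[of _ ?f]) auto
  qed
  \<comment> \<open>Points are extensional functions on \<open>bounded_ucont\<close>, so distinct
    points differ at a member of that family.\<close>
  have "\<zeta> \<in> extensional bounded_ucont" if "\<zeta> \<in> M_R z" for \<zeta>
    using that topspace_product_topology[of "\<lambda>_. euclideanreal" bounded_ucont]
      closure_of_subset_topspace[of "product_topology (\<lambda>_. euclideanreal) bounded_ucont"]
    by (auto simp: M_R_def samuel_def topspace_eval_closure PiE_def)
  then obtain h where h: "h \<in> bounded_ucont" "\<xi> h \<noteq> \<eta> h"
    using assms by (meson extensionalityI)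
  then consider "\<xi> h < \<eta> h" | "\<eta> h < \<xi> h" by linarith
  then show ?thesis
  proof cases
    case 1
    from *[OF assms(1,2) h(1) this] show ?thesis .
  next
    case 2
    from *[OF assms(2,1) h(1) this] show ?thesis by (auto dest: sym)
  qed
qed

lemma continuous_map_delta_R:
  assumes "L-lipschitz_on UNIV f"
  shows "continuous_map (subtopology samuel (M_R z)) euclideanreal (\<lambda>\<xi>. delta_R \<xi> f)"
proof -
  let ?h = "\<lambda>x. arctan (f x)"
  have "continuous_map (subtopology samuel (M_R z)) (top_of_set {- pi / 2<..<pi / 2}) (\<lambda>\<xi>. \<xi> ?h)"
    using continuous_map_eval[OF arctan_lipschitz_ucont[OF assms], of UNIV] delta_R_eq(2)[OF _ assms]
    by (fastforce simp: samuel_def continuous_map_in_subtopology continuous_map_from_subtopology abs_less_iff)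
  moreover have "continuous_on {- pi / 2<..<pi / 2} tan"
    using cos_gt_zero_pi by (intro continuous_intros) fastforce
  ultimately have "continuous_map (subtopology samuel (M_R z)) euclideanreal (\<lambda>\<xi>. tan (\<xi> ?h))"
    using continuous_map_compose[of _ _ "\<lambda>\<xi>. \<xi> ?h" euclideanreal tan] by (simp add: o_def)
  then show ?thesis
    by (rule continuous_map_eq) (auto simp: delta_R_eq(1)[OF _ assms])
qed


section \<open>The ball of Lipschitz functions and the metric on the realcompactification\<close>

text \<open>Each difference quotient is at most every Lipschitz constant of \<open>f\<close>, hence
  at most their infimum.\<close>

lemma Lip0_ball: "{f \<in> Lip0 z. lip_norm f \<le> 1} = {f. f z = 0 \<and> 1-lipschitz_on UNIV f}"
proof -
  have "1-lipschitz_on UNIV f" if f: "K-lipschitz_on UNIV f" and le: "lip_norm f \<le> 1"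
    for f :: "'a \<Rightarrow> real" and K
  proof (rule lipschitz_onI)
    fix x y
    let ?S = "{L. L-lipschitz_on UNIV f}"
    show "dist (f x) (f y) \<le> 1 * dist x y"
    proof (cases "x = y")
      case False
      have "dist (f x) (f y) / dist x y \<le> Inf ?S"
        using f False by (intro cInf_greatest) (auto simp: lipschitz_on_def divide_le_eq)
      also have "\<dots> \<le> 1" using le by (simp add: lip_norm_def)
      finally show ?thesis using False by (simp add: divide_le_eq)
    qed simp
  qed simp
  moreover have "lip_norm f \<le> 1" if "1-lipschitz_on UNIV f" for f :: "'a \<Rightarrow> real"
    unfolding lip_norm_def using that
    by (intro cInf_lower bdd_belowI[of _ 0]) (auto simp: lipschitz_on_def)
  ultimately show ?thesis by (auto simp: Lip0_def)
qed

text \<open>The bound \<open>B\<close> guarantees that the real-valued \<open>SUP\<close> is taken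
  over a bounded set; without boundedness it carries no information.\<close>

lemma dual_norm_upper:
  assumes "\<And>f. f z = 0 \<Longrightarrow> 1-lipschitz_on UNIV f \<Longrightarrow> \<bar>\<phi> f\<bar> \<le> B" "g z = 0" "1-lipschitz_on UNIV g"
  shows "\<bar>\<phi> g\<bar> \<le> dual_norm z \<phi>"
  unfolding dual_norm_def Lip0_ball
  by (rule cSUP_upper) (use assms in \<open>auto intro!: bdd_aboveI\<close>)

lemma dual_norm_least:
  assumes "\<And>f. f z = 0 \<Longrightarrow> 1-lipschitz_on UNIV f \<Longrightarrow> \<bar>\<phi> f\<bar> \<le> B"
  shows "dual_norm z \<phi> \<le> B"
  unfolding dual_norm_def Lip0_ball
  by (rule cSUP_least) (use assms in \<open>auto intro!: exI[of _ "\<lambda>_. 0"] simp: lipschitz_on_def\<close>)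

lemma dual_norm_approx:
  assumes "c < dual_norm z \<phi>"
  shows "\<exists>f. f z = 0 \<and> 1-lipschitz_on UNIV f \<and> c < \<bar>\<phi> f\<bar>"
  using dual_norm_least[of z \<phi> c] assms by (meson not_le)

lemma dual_norm_cong:
  assumes "\<And>f. f z = 0 \<Longrightarrow> 1-lipschitz_on UNIV f \<Longrightarrow> \<phi> f = \<psi> f"
  shows "dual_norm z \<phi> = dual_norm z \<psi>"
  unfolding dual_norm_def Lip0_ball by (rule SUP_cong) (auto simp: assms)

lemma lipschitz_add_const: "L-lipschitz_on UNIV f \<Longrightarrow> L-lipschitz_on UNIV (\<lambda>x. f x + c :: real)"
  by (auto simp: lipschitz_on_def)

lemma lipschitz_uminus: "L-lipschitz_on UNIV f \<Longrightarrow> L-lipschitz_on UNIV (\<lambda>x. - f x :: real)"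
  by (auto simp: lipschitz_on_def dist_real_def)

lemma lipschitz_max:
  assumes "L-lipschitz_on UNIV f" "L-lipschitz_on UNIV g"
  shows "L-lipschitz_on UNIV (\<lambda>x. max (f x) (g x) :: real)"
proof (rule lipschitz_onI)
  show "dist (max (f x) (g x)) (max (f y) (g y)) \<le> L * dist x y" for x y
    using lipschitz_onD[OF assms(1), of x y] lipschitz_onD[OF assms(2), of x y]
    by (auto simp: dist_real_def max_def abs_le_iff)
qed (rule lipschitz_on_nonneg[OF assms(1)])

lemma lipschitz_min:
  assumes "L-lipschitz_on UNIV f" "L-lipschitz_on UNIV g"
  shows "L-lipschitz_on UNIV (\<lambda>x. min (f x) (g x) :: real)"
proof (rule lipschitz_onI)
  show "dist (min (f x) (g x)) (min (f y) (g y)) \<le> L * dist x y" for x y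
    using lipschitz_onD[OF assms(1), of x y] lipschitz_onD[OF assms(2), of x y]
    by (auto simp: dist_real_def min_def abs_le_iff)
qed (rule lipschitz_on_nonneg[OF assms(1)])

section \<open>The extended metric as a supremum of differences of Lipschitz functions\<close>

lemma delta_R_lipschitz_bound:
  assumes "\<xi> \<in> M_R z" "1-lipschitz_on UNIV f"
  shows "\<bar>delta_R \<xi> f - f z\<bar> \<le> delta_R \<xi> (\<lambda>x. dist x z)"
proof (rule tendsto_le[OF tr_U_neq_bot[OF assms(1)]])
  show "((\<lambda>x. dist x z) \<longlongrightarrow> delta_R \<xi> (\<lambda>x. dist x z)) (tr_U \<xi>)"
    by (rule delta_R_tendsto[OF assms(1) dist_lipschitz])
  show "((\<lambda>x. \<bar>f x - f z\<bar>) \<longlongrightarrow> \<bar>delta_R \<xi> f - f z\<bar>) (tr_U \<xi>)"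
    by (intro tendsto_intros delta_R_tendsto[OF assms])
  show "\<forall>\<^sub>F x in tr_U \<xi>. \<bar>f x - f z\<bar> \<le> dist x z"
    using assms(2) by (auto simp: lipschitz_on_def dist_real_def)
qed

text \<open>Subtracting \<open>f z\<close> moves \<open>f\<close> into the unit ball of
  \<open>Lip0 z\<close> and leaves the difference unchanged.\<close>

lemma dist_R_upper:
  assumes "\<xi> \<in> M_R z" "\<eta> \<in> M_R z" "1-lipschitz_on UNIV f"
  shows "delta_R \<xi> f - delta_R \<eta> f \<le> dist_R z \<xi> \<eta>"
proof -
  let ?r = "\<lambda>\<xi>. delta_R \<xi> (\<lambda>x. dist x z)"
  let ?g = "\<lambda>x. f x + (- f z)"
  have g: "1-lipschitz_on UNIV ?g" by (rule lipschitz_add_const[OF assms(3)])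
  have "\<bar>delta_R \<xi> ?g - delta_R \<eta> ?g\<bar> \<le> dist_R z \<xi> \<eta>"
    unfolding dist_R_def
  proof (rule dual_norm_upper[of z _ "?r \<xi> + ?r \<eta>"])
    show "\<bar>delta_R \<xi> h - delta_R \<eta> h\<bar> \<le> ?r \<xi> + ?r \<eta>" if "1-lipschitz_on UNIV h" for h
      using delta_R_lipschitz_bound[OF assms(1) that] delta_R_lipschitz_bound[OF assms(2) that] by linarith
  qed (use g in auto)
  moreover have "delta_R \<zeta> ?g = delta_R \<zeta> f + (- f z)" if "\<zeta> \<in> M_R z" for \<zeta>
    by (rule delta_R_eqI[OF that g]) (intro tendsto_intros delta_R_tendsto[OF that assms(3)])
  ultimately show ?thesis using assms by simp
qed

lemma delta_R_uminus:
  assumes "\<xi> \<in> M_R z" "L-lipschitz_on UNIV f"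
  shows "delta_R \<xi> (\<lambda>x. - f x) = - delta_R \<xi> f"
  by (rule delta_R_eqI[OF assms(1) lipschitz_uminus[OF assms(2)]])
    (intro tendsto_intros delta_R_tendsto[OF assms])

lemma dist_R_approx:
  assumes "\<xi> \<in> M_R z" "\<eta> \<in> M_R z" "c < dist_R z \<xi> \<eta>"
  shows "\<exists>f. 1-lipschitz_on UNIV f \<and> c < delta_R \<xi> f - delta_R \<eta> f"
proof -
  obtain f where f: "1-lipschitz_on UNIV f" "c < \<bar>delta_R \<xi> f - delta_R \<eta> f\<bar>"
    using dual_norm_approx assms(3) unfolding dist_R_def by blast
  show ?thesis
  proof (cases "c < delta_R \<xi> f - delta_R \<eta> f")
    case False
    then show ?thesis
      using f lipschitz_uminus[OF f(1)] delta_R_uminus[OF assms(1) f(1)] delta_R_uminus[OF assms(2) f(1)]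
      by (intro exI[of _ "\<lambda>x. - f x"]) auto
  qed (use f in blast)
qed

lemma dist_R_commute: "dist_R z \<xi> \<eta> = dist_R z \<eta> \<xi>"
  unfolding dist_R_def dual_norm_def by (simp add: abs_minus_commute)

lemma dist_R_le_radius:
  assumes "\<xi> \<in> M_R z" "\<eta> \<in> M_R z"
  shows "dist_R z \<xi> \<eta> \<le> delta_R \<xi> (\<lambda>x. dist x z) + delta_R \<eta> (\<lambda>x. dist x z)"
  unfolding dist_R_def
proof (rule dual_norm_least)
  show "\<bar>delta_R \<xi> h - delta_R \<eta> h\<bar> \<le> delta_R \<xi> (\<lambda>x. dist x z) + delta_R \<eta> (\<lambda>x. dist x z)"
    if "1-lipschitz_on UNIV h" for h
    using delta_R_lipschitz_bound[OF assms(1) that] delta_R_lipschitz_bound[OF assms(2) that] by linarith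
qed

text \<open>Membership constrains \<open>g\<close> on \<open>M_R z\<close> alone, so the set is
  closed under pointwise maxima, minima and translations by constants as total functions.\<close>

definition lip_ext :: "'a::metric_space \<Rightarrow> ('a u_point \<Rightarrow> real) set" where
  "lip_ext z = {g. \<exists>f. 1-lipschitz_on UNIV f \<and> (\<forall>\<xi>\<in>M_R z. g \<xi> = delta_R \<xi> f)}"

lemma lip_extI:
  assumes "1-lipschitz_on UNIV f" "\<And>\<xi>. \<xi> \<in> M_R z \<Longrightarrow> (f \<longlongrightarrow> g \<xi>) (tr_U \<xi>)"
  shows "g \<in> lip_ext z"
  unfolding lip_ext_def using assms delta_R_eqI[OF _ assms(1) assms(2)] by fastforce

lemma lip_extE:
  assumes "g \<in> lip_ext z"
  obtains f where "1-lipschitz_on UNIV f" "\<And>\<xi>. \<xi> \<in> M_R z \<Longrightarrow> (f \<longlongrightarrow> g \<xi>) (tr_U \<xi>)"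
  using assms delta_R_tendsto unfolding lip_ext_def by fastforce

lemma lip_ext_max:
  assumes "f \<in> lip_ext z" "g \<in> lip_ext z"
  shows "(\<lambda>\<xi>. max (f \<xi>) (g \<xi>)) \<in> lip_ext z"
  by (rule lip_extE[OF assms(1)], rule lip_extE[OF assms(2)], rule lip_extI, erule lipschitz_max, assumption)
    (rule tendsto_max; blast)

lemma lip_ext_min:
  assumes "f \<in> lip_ext z" "g \<in> lip_ext z"
  shows "(\<lambda>\<xi>. min (f \<xi>) (g \<xi>)) \<in> lip_ext z"
  by (rule lip_extE[OF assms(1)], rule lip_extE[OF assms(2)], rule lip_extI, erule lipschitz_min, assumption)
    (rule tendsto_min; blast)

lemma lip_ext_add_const:
  assumes "f \<in> lip_ext z"
  shows "(\<lambda>\<xi>. f \<xi> + c) \<in> lip_ext z"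
  by (rule lip_extE[OF assms], rule lip_extI, erule lipschitz_add_const)
    (rule tendsto_add[OF _ tendsto_const]; blast)


section \<open>Potentials of cyclically monotonic sets\<close>

text \<open>The cycle through which cyclic monotonicity bounds a closed chain: each link is paired
  with the next and the last with the first.\<close>

lemma cyclic_shift_permutes:
  "(\<lambda>k. if k = Suc m then 1 else if 1 \<le> k \<and> k \<le> m then Suc k else k) permutes {1..Suc m}"
    (is "?\<sigma> permutes ?S")
proof (rule bij_imp_permutes)
  have "inj_on ?\<sigma> ?S" "?\<sigma> ` ?S \<subseteq> ?S" by (auto simp: inj_on_def)
  then show "bij_betw ?\<sigma> ?S ?S"
    unfolding bij_betw_def by (blast dest: endo_inj_surj[rotated 2] intro: finite_atLeastAtMost)
qed auto

text \<open>Isolates what the potential argument uses: a lattice of functions whose differences have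
  supremum \<open>dm\<close>. It is applied with extended 1-Lipschitz functions for
  \<open>Lf\<close>, \<open>M_R z\<close> for \<open>E\<close>, the distance to \<open>z\<close> for
  \<open>\<rho>\<close>, a compact set for \<open>T\<close> and \<open>gap\<close> for
  \<open>D\<close>. No topology on \<open>E\<close> is involved; continuity is asked after
  composition with \<open>p\<close> and \<open>q\<close>.\<close>

locale monotonic_contact =
  fixes Lf :: "('p \<Rightarrow> real) set" and E :: "'p set" and \<rho> :: "'p \<Rightarrow> real" and dm :: "'p \<Rightarrow> 'p \<Rightarrow> real"
    and T :: "'k topology" and p q :: "'k \<Rightarrow> 'p" and D :: "'k \<Rightarrow> real"
  assumes Lf_max: "f \<in> Lf \<Longrightarrow> g \<in> Lf \<Longrightarrow> (\<lambda>\<xi>. max (f \<xi>) (g \<xi>)) \<in> Lf"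
    and Lf_min: "f \<in> Lf \<Longrightarrow> g \<in> Lf \<Longrightarrow> (\<lambda>\<xi>. min (f \<xi>) (g \<xi>)) \<in> Lf"
    and Lf_add_const: "f \<in> Lf \<Longrightarrow> (\<lambda>\<xi>. f \<xi> + c) \<in> Lf"
    and radius_Lf: "\<rho> \<in> Lf"
    and dm_upper: "\<xi> \<in> E \<Longrightarrow> \<eta> \<in> E \<Longrightarrow> f \<in> Lf \<Longrightarrow> f \<xi> - f \<eta> \<le> dm \<xi> \<eta>"
    and dm_approx: "\<xi> \<in> E \<Longrightarrow> \<eta> \<in> E \<Longrightarrow> c < dm \<xi> \<eta> \<Longrightarrow> \<exists>f\<in>Lf. c < f \<xi> - f \<eta>"
    and dm_commute: "dm \<xi> \<eta> = dm \<eta> \<xi>"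
    and dm_le_radius: "\<xi> \<in> E \<Longrightarrow> \<eta> \<in> E \<Longrightarrow> dm \<xi> \<eta> \<le> \<rho> \<xi> + \<rho> \<eta>"
    and compact_T: "compact_space T"
    and p_in: "\<zeta> \<in> topspace T \<Longrightarrow> p \<zeta> \<in> E" and q_in: "\<zeta> \<in> topspace T \<Longrightarrow> q \<zeta> \<in> E"
    and cont_p: "f \<in> Lf \<Longrightarrow> continuous_map T euclideanreal (\<lambda>\<zeta>. f (p \<zeta>))"
    and cont_q: "f \<in> Lf \<Longrightarrow> continuous_map T euclideanreal (\<lambda>\<zeta>. f (q \<zeta>))"
    and cont_D: "continuous_map T euclideanreal D"
    and D_eq: "\<zeta> \<in> topspace T \<Longrightarrow> D \<zeta> = dm (p \<zeta>) (q \<zeta>)"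
    and cyclic: "cyclically_monotonic dm ((\<lambda>\<zeta>. (p \<zeta>, q \<zeta>)) ` topspace T)"
begin

text \<open>\<open>dm\<close> is a supremum of differences, and differences telescope.\<close>

lemma dm_triangle:
  assumes "\<xi> \<in> E" "\<eta> \<in> E" "\<zeta> \<in> E"
  shows "dm \<xi> \<zeta> \<le> dm \<xi> \<eta> + dm \<eta> \<zeta>"
proof (rule ccontr)
  assume "\<not> ?thesis"
  then obtain f where "f \<in> Lf" "dm \<xi> \<eta> + dm \<eta> \<zeta> < f \<xi> - f \<zeta>"
    using dm_approx[OF assms(1,3)] by (meson not_le)
  then show False using dm_upper[OF assms(1,2)] dm_upper[OF assms(2,3)] by fastforce
qed

lemma dm_self: "\<xi> \<in> E \<Longrightarrow> dm \<xi> \<xi> = 0"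
  using dm_approx[of \<xi> \<xi> 0] dm_upper[OF _ _ radius_Lf, of \<xi> \<xi>] by force

lemma radius_nonneg: "\<xi> \<in> E \<Longrightarrow> 0 \<le> \<rho> \<xi>"
  using dm_le_radius[of \<xi> \<xi>] dm_self by simp

text \<open>Rockafellar's chain sum: each link costs the distance from \<open>\<xi>\<close> to
  \<open>q \<zeta>\<close> and gains \<open>D \<zeta>\<close> in moving on to
  \<open>p \<zeta>\<close>. The terminal cost \<open>\<rho>\<close> replaces a fixed anchor, so the
  empty chain yields a member of \<open>Lf\<close>.\<close>

primrec chain_value :: "'k list \<Rightarrow> 'p \<Rightarrow> real" where
  "chain_value [] \<xi> = \<rho> \<xi>"
| "chain_value (\<zeta> # \<zeta>s) \<xi> = chain_value \<zeta>s (p \<zeta>) - D \<zeta> + dm (q \<zeta>) \<xi>"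

lemma chain_value_eq:
  "length \<zeta>s = Suc m \<Longrightarrow>
    chain_value \<zeta>s \<xi> = dm (q (\<zeta>s ! 0)) \<xi> + (\<Sum>i<m. dm (p (\<zeta>s ! i)) (q (\<zeta>s ! Suc i)))
      - (\<Sum>i<Suc m. D (\<zeta>s ! i)) + \<rho> (p (\<zeta>s ! m))"
proof (induction m arbitrary: \<zeta>s \<xi>)
  case 0
  then obtain \<zeta> where "\<zeta>s = [\<zeta>]" by (auto simp: length_Suc_conv)
  then show ?case by simp
next
  case (Suc m)
  then obtain \<zeta> \<zeta>s' where \<zeta>s: "\<zeta>s = \<zeta> # \<zeta>s'" "length \<zeta>s' = Suc m" by (auto simp: length_Suc_conv)
  show ?case
    unfolding \<zeta>s(1) chain_value.simps Suc.IH[OF \<zeta>s(2)]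
      sum.lessThan_Suc_shift[of "\<lambda>i. D ((\<zeta> # \<zeta>s') ! i)"]
      sum.lessThan_Suc_shift[of "\<lambda>i. dm (p ((\<zeta> # \<zeta>s') ! i)) (q ((\<zeta> # \<zeta>s') ! Suc i))"]
    by (simp add: dm_commute)
qed

text \<open>Closing the chain into a cycle bounds the total of \<open>D\<close> by cyclic
  monotonicity. The closing edge is routed through \<open>\<xi>\<close>, which costs the first
  distance of the chain, the terminal \<open>\<rho>\<close> and \<open>\<rho> \<xi>\<close>. This
  makes the infimum in \<open>potential\<close> meaningful.\<close>

lemma chain_value_lower:
  assumes "\<zeta>s \<in> lists (topspace T)" "\<xi> \<in> E"
  shows "- \<rho> \<xi> \<le> chain_value \<zeta>s \<xi>"
proof (cases "length \<zeta>s")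
  case 0
  then show ?thesis using radius_nonneg[OF assms(2)] by simp
next
  case (Suc m)
  have K: "\<zeta>s ! i \<in> topspace T" if "i < Suc m" for i
    using assms(1) that Suc by (simp add: in_lists_conv_set)
  let ?\<sigma> = "\<lambda>k. if k = Suc m then 1 else if 1 \<le> k \<and> k \<le> m then Suc k else k"
  \<comment> \<open>\<open>cyclically_monotonic\<close> counts from 1 and lists from 0, hence the
    index \<open>k - 1\<close>.\<close>
  have "(\<Sum>k=1..Suc m. dm (p (\<zeta>s ! (k - 1))) (q (\<zeta>s ! (k - 1))))
      \<le> (\<Sum>k=1..Suc m. dm (p (\<zeta>s ! (k - 1))) (q (\<zeta>s ! (?\<sigma> k - 1))))"
    using cyclic[unfolded cyclically_monotonic_def, rule_format,
        of "Suc m" "\<lambda>k. p (\<zeta>s ! (k - 1))" "\<lambda>k. q (\<zeta>s ! (k - 1))" ?\<sigma>] K cyclic_shift_permutes[of m]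
    by fastforce
  then have "(\<Sum>i<Suc m. D (\<zeta>s ! i))
      \<le> (\<Sum>i<m. dm (p (\<zeta>s ! i)) (q (\<zeta>s ! Suc i))) + dm (p (\<zeta>s ! m)) (q (\<zeta>s ! 0))"
    using K by (simp add: sum.atLeast1_atMost_eq D_eq del: sum.cl_ivl_Suc)
  moreover have "dm (p (\<zeta>s ! m)) (q (\<zeta>s ! 0)) \<le> dm (p (\<zeta>s ! m)) \<xi> + dm (q (\<zeta>s ! 0)) \<xi>"
    using dm_triangle[of "p (\<zeta>s ! m)" \<xi> "q (\<zeta>s ! 0)"] p_in[OF K] q_in[OF K] assms(2) dm_commute by simp
  moreover have "dm (p (\<zeta>s ! m)) \<xi> \<le> \<rho> (p (\<zeta>s ! m)) + \<rho> \<xi>"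
    using p_in[OF K] assms(2) by (intro dm_le_radius) auto
  ultimately show ?thesis unfolding chain_value_eq[OF Suc] by linarith
qed

text \<open>The length bound permits induction on \<open>n\<close>; the infimum over chains of all
  lengths would be the full Rockafellar potential.\<close>

definition potential :: "nat \<Rightarrow> 'p \<Rightarrow> real" where
  "potential n \<xi> = (INF \<zeta>s \<in> {\<zeta>s \<in> lists (topspace T). length \<zeta>s \<le> n}. chain_value \<zeta>s \<xi>)"

lemma potential_le:
  assumes "\<xi> \<in> E" "\<zeta>s \<in> lists (topspace T)" "length \<zeta>s \<le> n"
  shows "potential n \<xi> \<le> chain_value \<zeta>s \<xi>"
  unfolding potential_def
  by (rule cINF_lower) (use assms chain_value_lower in \<open>auto intro!: bdd_belowI[of _ "- \<rho> \<xi>"]\<close>)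

lemma potential_ge:
  assumes "\<And>\<zeta>s. \<zeta>s \<in> lists (topspace T) \<Longrightarrow> length \<zeta>s \<le> n \<Longrightarrow> c \<le> chain_value \<zeta>s \<xi>"
  shows "c \<le> potential n \<xi>"
  unfolding potential_def
  by (rule cINF_greatest) (use assms in \<open>auto intro!: exI[of _ "[]"]\<close>)

lemma potential_lower: "\<xi> \<in> E \<Longrightarrow> - \<rho> \<xi> \<le> potential n \<xi>"
  by (rule potential_ge) (rule chain_value_lower)

lemma potential_upper: "\<xi> \<in> E \<Longrightarrow> potential n \<xi> \<le> \<rho> \<xi>"
  using potential_le[of \<xi> "[]" n] by simp

lemma potential_Suc_le: "\<xi> \<in> E \<Longrightarrow> potential (Suc n) \<xi> \<le> potential n \<xi>"
  by (rule potential_ge) (rule potential_le; simp)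

text \<open>Prepends the link \<open>\<zeta>\<close> to a chain that starts at
  \<open>p \<zeta>\<close>. For \<open>\<xi> = q \<zeta>\<close>, the drop from
  \<open>potential n\<close> to \<open>potential (Suc n)\<close> at \<open>p \<zeta>\<close> is then
  all that keeps the latter from attaining \<open>D \<zeta>\<close>.\<close>

lemma potential_step:
  assumes "\<zeta> \<in> topspace T" "\<xi> \<in> E"
  shows "potential (Suc n) \<xi> \<le> potential n (p \<zeta>) - D \<zeta> + dm (q \<zeta>) \<xi>"
proof -
  have "potential (Suc n) \<xi> + D \<zeta> - dm (q \<zeta>) \<xi> \<le> potential n (p \<zeta>)"
  proof (rule potential_ge)
    show "potential (Suc n) \<xi> + D \<zeta> - dm (q \<zeta>) \<xi> \<le> chain_value \<zeta>s (p \<zeta>)"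
      if "\<zeta>s \<in> lists (topspace T)" "length \<zeta>s \<le> n" for \<zeta>s
      using potential_le[OF assms(2), of "\<zeta> # \<zeta>s" "Suc n"] that assms(1) by simp
  qed
  then show ?thesis by simp
qed

section \<open>Potentials as suprema of Lipschitz minorants\<close>

definition below :: "('p \<Rightarrow> real) \<Rightarrow> ('p \<Rightarrow> real) set" where
  "below G = {f \<in> Lf. \<forall>\<xi>\<in>E. f \<xi> \<le> G \<xi>}"

text \<open>On \<open>E\<close>, the function \<open>G\<close> is the pointwise supremum of its
  minorants in \<open>Lf\<close>. After composition with \<open>p\<close> or \<open>q\<close> this
  gives lower semicontinuity.\<close>

definition representable :: "('p \<Rightarrow> real) \<Rightarrow> bool" where
  "representable G \<longleftrightarrow> (\<forall>\<xi>\<in>E. \<forall>c<G \<xi>. \<exists>f\<in>below G. c < f \<xi>)"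

lemma representableE:
  assumes "representable G" "\<xi> \<in> E" "c < G \<xi>"
  obtains f where "f \<in> Lf" "\<And>\<xi>. \<xi> \<in> E \<Longrightarrow> f \<xi> \<le> G \<xi>" "c < f \<xi>"
  using assms unfolding representable_def below_def by blast

text \<open>A nonempty chain is a link followed by a shorter chain, and \<open>f \<xi>\<close>
  exceeds \<open>f (q \<zeta>)\<close> by at most \<open>dm\<close>; so testing \<open>f\<close> at
  the points \<open>q \<zeta>\<close> controls every \<open>\<xi>\<close>.\<close>

lemma below_potential_SucI:
  assumes "f \<in> Lf" "\<And>\<xi>. \<xi> \<in> E \<Longrightarrow> f \<xi> \<le> potential n \<xi>"
    and step: "\<And>\<zeta>. \<zeta> \<in> topspace T \<Longrightarrow> f (q \<zeta>) \<le> potential n (p \<zeta>) - D \<zeta>"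
  shows "f \<in> below (potential (Suc n))"
  unfolding below_def
proof (intro CollectI conjI ballI assms(1), rule potential_ge)
  fix \<xi> \<zeta>s assume \<xi>: "\<xi> \<in> E" and \<zeta>s: "\<zeta>s \<in> lists (topspace T)" "length \<zeta>s \<le> Suc n"
  show "f \<xi> \<le> chain_value \<zeta>s \<xi>"
  proof (cases \<zeta>s)
    case Nil
    then show ?thesis using assms(2)[OF \<xi>] potential_upper[OF \<xi>, of n] by simp
  next
    case (Cons \<zeta> \<zeta>s')
    then have \<zeta>: "\<zeta> \<in> topspace T" and \<zeta>s': "\<zeta>s' \<in> lists (topspace T)" "length \<zeta>s' \<le> n"
      using \<zeta>s by auto
    have "f \<xi> - f (q \<zeta>) \<le> dm (q \<zeta>) \<xi>"
      using dm_upper[OF \<xi> q_in[OF \<zeta>] assms(1)] dm_commute by simp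
    moreover note step[OF \<zeta>] potential_le[OF p_in[OF \<zeta>] \<zeta>s']
    ultimately show ?thesis unfolding Cons chain_value.simps by linarith
  qed
qed

text \<open>For each link there is a function with value \<open>r\<close> at \<open>\<xi>\<close>
  that meets the condition of \<open>below_potential_SucI\<close> strictly there, hence on a
  neighbourhood. Finitely many neighbourhoods cover \<open>T\<close>, and the minimum of their
  functions meets the condition everywhere while keeping the value \<open>r\<close>.\<close>

lemma representable_potential: "representable (potential n)"
proof (induction n)
  case 0
  have "potential 0 = \<rho>"
    by (rule ext) (simp add: potential_def)
  then show ?case unfolding representable_def below_def using radius_Lf by auto
next
  case (Suc n)
  show ?case
    unfolding representable_def
  proof (intro ballI allI impI)
    fix \<xi> c assume \<xi>: "\<xi> \<in> E" and c: "c < potential (Suc n) \<xi>"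
    then obtain r where r: "c < r" "r < potential (Suc n) \<xi>" using dense by blast
    have "\<exists>f U. f \<in> Lf \<and> f \<xi> = r \<and> openin T U \<and> \<zeta> \<in> U \<and>
        (\<forall>\<zeta>'\<in>U. f (q \<zeta>') \<le> potential n (p \<zeta>') - D \<zeta>')" if \<zeta>: "\<zeta> \<in> topspace T" for \<zeta>
    proof -
      have "r - (potential n (p \<zeta>) - D \<zeta>) < dm \<xi> (q \<zeta>)"
        using potential_step[OF \<zeta> \<xi>, of n] r(2) dm_commute[of \<xi>] by simp
      then obtain f0 where f0: "f0 \<in> Lf" "r - (potential n (p \<zeta>) - D \<zeta>) < f0 \<xi> - f0 (q \<zeta>)"
        using dm_approx[OF \<xi> q_in[OF \<zeta>]] by blast
      \<comment> \<open>Translated to take the value \<open>r\<close> exactly at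
        \<open>\<xi>\<close>, so that finite minima lose nothing there.\<close>
      define f where "f = (\<lambda>\<eta>. f0 \<eta> + (r - f0 \<xi>))"
      have f: "f \<in> Lf" "f \<xi> = r" "f (q \<zeta>) + D \<zeta> < potential n (p \<zeta>)"
        using f0 Lf_add_const by (auto simp: f_def)
      \<comment> \<open>\<open>potential n\<close> need not be continuous along \<open>p\<close>; a
        minorant \<open>g\<close> that is continuous along \<open>p\<close> turns the strict
        inequality at \<open>\<zeta>\<close> into an open condition.\<close>
      from representableE[OF Suc.IH p_in[OF \<zeta>] f(3)]
      obtain g where g: "g \<in> Lf" "\<And>\<eta>. \<eta> \<in> E \<Longrightarrow> g \<eta> \<le> potential n \<eta>" "f (q \<zeta>) + D \<zeta> < g (p \<zeta>)"
        by blast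
      let ?h = "\<lambda>\<zeta>'. g (p \<zeta>') - (f (q \<zeta>') + D \<zeta>')"
      have "continuous_map T euclideanreal ?h"
        by (intro continuous_map_diff continuous_map_add cont_p cont_q cont_D f g)
      then have "openin T {\<zeta>' \<in> topspace T. ?h \<zeta>' \<in> {0<..}}"
        by (rule openin_continuous_map_preimage) simp
      moreover have "\<zeta> \<in> {\<zeta>' \<in> topspace T. ?h \<zeta>' \<in> {0<..}}" using \<zeta> g(3) by simp
      moreover have "f (q \<zeta>') \<le> potential n (p \<zeta>') - D \<zeta>'"
        if "\<zeta>' \<in> {\<zeta>' \<in> topspace T. ?h \<zeta>' \<in> {0<..}}" for \<zeta>'
        using that g(2)[OF p_in[of \<zeta>']] by auto
      ultimately show ?thesis using f(1,2) by blast
    qed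
    then obtain f U where fU: "\<And>\<zeta>. \<zeta> \<in> topspace T \<Longrightarrow> f \<zeta> \<in> Lf \<and> f \<zeta> \<xi> = r \<and> openin T (U \<zeta>) \<and>
        \<zeta> \<in> U \<zeta> \<and> (\<forall>\<zeta>'\<in>U \<zeta>. f \<zeta> (q \<zeta>') \<le> potential n (p \<zeta>') - D \<zeta>')"
      by metis
    have "compactin T (topspace T)" using compact_T by (simp add: compact_space_def)
    then obtain \<F> where \<F>: "finite \<F>" "\<F> \<subseteq> U ` topspace T" "topspace T \<subseteq> \<Union>\<F>"
      using compactinD[of T "topspace T" "U ` topspace T"] fU by blast
    then obtain Z where Z: "finite Z" "Z \<subseteq> topspace T" "\<F> = U ` Z"
      by (meson finite_subset_image)
    have r_less: "r < potential n \<xi>" using r(2) potential_Suc_le[OF \<xi>, of n] by simp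
    have "\<exists>h\<in>Lf. (\<forall>\<eta>\<in>E. h \<eta> \<le> potential n \<eta>) \<and> r \<le> h \<xi> \<and>
        (\<forall>\<zeta>'\<in>topspace T \<inter> (\<Union>\<zeta>\<in>Z. U \<zeta>). h (q \<zeta>') \<le> potential n (p \<zeta>') - D \<zeta>')"
      using Z(1,2)
    proof (induction Z)
      case empty
      \<comment> \<open>The minima start from a minorant of \<open>potential n\<close>, which takes
        care of short chains, including the empty one.\<close>
      from representableE[OF Suc.IH \<xi> r_less] obtain g
        where "g \<in> Lf" "\<And>\<eta>. \<eta> \<in> E \<Longrightarrow> g \<eta> \<le> potential n \<eta>" "r < g \<xi>" by blast
      then show ?case by (intro bexI[of _ g]) auto
    next
      case (insert \<zeta> Z)
      then obtain h where h: "h \<in> Lf" "\<forall>\<eta>\<in>E. h \<eta> \<le> potential n \<eta>" "r \<le> h \<xi>"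
        "\<forall>\<zeta>'\<in>topspace T \<inter> (\<Union>\<zeta>\<in>Z. U \<zeta>). h (q \<zeta>') \<le> potential n (p \<zeta>') - D \<zeta>'" by auto
      have "\<zeta> \<in> topspace T" using insert by simp
      note f = fU[OF this]
      let ?k = "\<lambda>\<eta>. min (h \<eta>) (f \<zeta> \<eta>)"
      have "?k \<in> Lf" using h(1) f by (intro Lf_min) auto
      moreover have "\<forall>\<eta>\<in>E. ?k \<eta> \<le> potential n \<eta>" using h(2) by (auto simp: min_le_iff_disj)
      moreover have "r \<le> ?k \<xi>" using h(3) f by auto
      moreover have "\<forall>\<zeta>'\<in>topspace T \<inter> (\<Union>\<zeta>\<in>insert \<zeta> Z. U \<zeta>). ?k (q \<zeta>') \<le> potential n (p \<zeta>') - D \<zeta>'"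
        using h(4) f by (auto simp: min_le_iff_disj)
      ultimately show ?case by (intro bexI[of _ ?k] conjI)
    qed
    then obtain h where h: "h \<in> Lf" "\<And>\<eta>. \<eta> \<in> E \<Longrightarrow> h \<eta> \<le> potential n \<eta>" "r \<le> h \<xi>"
      "\<And>\<zeta>'. \<zeta>' \<in> topspace T \<Longrightarrow> h (q \<zeta>') \<le> potential n (p \<zeta>') - D \<zeta>'"
      using \<F>(3) Z(3) by blast
    have "h \<in> below (potential (Suc n))" by (rule below_potential_SucI[OF h(1,2,4)])
    moreover have "c < h \<xi>" using h(3) r(1) by simp
    ultimately show "\<exists>f\<in>below (potential (Suc n)). c < f \<xi>" by blast
  qed
qed

end


section \<open>Approximating potentials in measure\<close>

lemma sets_borel_alg_openin: "openin X U \<Longrightarrow> U \<in> sets (borel_alg X)"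
  unfolding borel_alg_def using openin_subset by (subst sets_measure_of) (auto intro: sigma_sets.Basic)

lemma space_borel_alg: "space (borel_alg X) = topspace X"
  unfolding borel_alg_def using openin_subset by (intro space_measure_of) blast

lemma sets_borel_alg_closedin: "closedin X C \<Longrightarrow> C \<in> sets (borel_alg X)"
  using sets.compl_sets[OF sets_borel_alg_openin[of X "topspace X - C"]]
  by (simp add: space_borel_alg closedin_def double_diff)

text \<open>\<open>T\<close> becomes a closed subspace of an ambient space \<open>X\<close> carrying
  the measure. Inner regularity by closed sets then supplies compact subsets inside
  \<open>T\<close>.\<close>

locale monotonic_contact_measure = monotonic_contact +
  fixes X :: "'b topology" and \<mu> :: "'b measure"
  assumes T_eq: "T = subtopology X (topspace T)" and closed_T: "closedin X (topspace T)"
    and finite_\<mu>: "finite_measure \<mu>" and sets_\<mu>: "sets \<mu> = sets (borel_alg X)"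
    and inner_closed: "\<And>A e. A \<in> sets \<mu> \<Longrightarrow> 0 < e \<Longrightarrow> \<exists>C. closedin X C \<and> C \<subseteq> A \<and> measure \<mu> (A - C) < e"
begin

interpretation finite_measure \<mu> by (rule finite_\<mu>)

lemma openin_T_sets: "openin T U \<Longrightarrow> U \<in> sets \<mu>"
  using sets_borel_alg_openin[of X] sets_borel_alg_closedin[OF closed_T]
  unfolding sets_\<mu> by (subst (asm) T_eq) (auto simp: openin_subtopology intro!: sets.Int)

lemma topspace_T_sets: "topspace T \<in> sets \<mu>"
  by (rule openin_T_sets) simp

lemma below_max:
  "f \<in> below G \<Longrightarrow> g \<in> below G \<Longrightarrow> (\<lambda>\<xi>. max (f \<xi>) (g \<xi>)) \<in> below G"
  by (auto simp: below_def Lf_max)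

lemma endpoint_in: "s \<in> {p, q} \<Longrightarrow> \<zeta> \<in> topspace T \<Longrightarrow> s \<zeta> \<in> E"
  using p_in q_in by auto

lemma openin_greater:
  assumes "s \<in> {p, q}" "f \<in> Lf"
  shows "openin T {\<zeta> \<in> topspace T. c < f (s \<zeta>)}"
proof -
  have "continuous_map T euclideanreal (\<lambda>\<zeta>. f (s \<zeta>))"
    using assms cont_p[of f] cont_q[of f] by auto
  then show ?thesis using openin_continuous_map_preimage[of T euclideanreal _ "{c<..}"] by simp
qed

lemma openin_representable_greater:
  assumes "s \<in> {p, q}" "representable G"
  shows "openin T {\<zeta> \<in> topspace T. c < G (s \<zeta>)}"
proof -
  have "{\<zeta> \<in> topspace T. c < G (s \<zeta>)} = (\<Union>f\<in>below G. {\<zeta> \<in> topspace T. c < f (s \<zeta>)})"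
    using endpoint_in[OF assms(1)] assms(2) unfolding representable_def by (fastforce simp: below_def)
  then show ?thesis
    using openin_greater[OF assms(1)] by (auto simp: below_def)
qed

text \<open>Here \<open>s\<close> is one of the endpoint maps and \<open>c\<close> a level. Outside
  the deficits at all levels of a finite grid covering the range of \<open>G\<close>, a minorant
  \<open>f\<close> differs from \<open>G\<close> by at most the mesh. Levels and maps are paired to
  index one finite union.\<close>

definition deficit :: "('p \<Rightarrow> real) \<Rightarrow> ('p \<Rightarrow> real) \<Rightarrow> ('b \<Rightarrow> 'p) \<times> real \<Rightarrow> 'b set" where
  "deficit G f = (\<lambda>(s, c). {\<zeta> \<in> topspace T. c < G (s \<zeta>) \<and> f (s \<zeta>) \<le> c})"

lemma deficit_sets:
  assumes "s \<in> {p, q}" "representable G" "f \<in> Lf"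
  shows "deficit G f (s, c) \<in> sets \<mu>"
proof -
  have "deficit G f (s, c) = {\<zeta> \<in> topspace T. c < G (s \<zeta>)} - {\<zeta> \<in> topspace T. c < f (s \<zeta>)}"
    by (auto simp: deficit_def)
  then show ?thesis
    using openin_T_sets[OF openin_representable_greater[OF assms(1,2)]]
      openin_T_sets[OF openin_greater[OF assms(1,3)]] by (simp add: sets.Diff)
qed

text \<open>A Dini-type argument: the open set where \<open>G\<close> exceeds \<open>c\<close>
  contains a compact set of nearly full measure, covered by the sets where minorants exceed
  \<open>c\<close>. The maximum of finitely many of them suffices.\<close>

lemma small_deficit:
  assumes s: "s \<in> {p, q}" and G: "representable G" and ne: "below G \<noteq> {}" and e: "0 < e"
  shows "\<exists>f\<in>below G. measure \<mu> (deficit G f (s, c)) < e"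
proof -
  let ?O = "{\<zeta> \<in> topspace T. c < G (s \<zeta>)}" and ?U = "\<lambda>f. {\<zeta> \<in> topspace T. c < f (s \<zeta>)}"
  have O: "?O \<in> sets \<mu>" by (rule openin_T_sets[OF openin_representable_greater[OF s G]])
  then obtain C where C: "closedin X C" "C \<subseteq> ?O" "measure \<mu> (?O - C) < e"
    using inner_closed e by blast
  have "closedin T C"
    using C(1,2) by (subst T_eq, intro closedin_subset_topspace) auto
  then have "compactin T C" using compact_T closedin_compact_space by blast
  moreover have "\<And>U. U \<in> ?U ` below G \<Longrightarrow> openin T U"
    using openin_greater[OF s] by (auto simp: below_def)
  moreover have "C \<subseteq> \<Union> (?U ` below G)"
    using C(2) endpoint_in[OF s] G unfolding representable_def by fastforce
  ultimately obtain \<F> where \<F>: "finite \<F>" "\<F> \<subseteq> ?U ` below G" "C \<subseteq> \<Union>\<F>"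
    using compactinD[of T C "?U ` below G"] by blast
  then obtain H where H: "finite H" "H \<subseteq> below G" "\<F> = ?U ` H"
    by (meson finite_subset_image)
  have "\<exists>f\<in>below G. \<forall>h\<in>H. \<forall>\<xi>. h \<xi> \<le> f \<xi>"
    using H(1,2)
  proof (induction H)
    case (insert h H)
    then obtain f where "f \<in> below G" "\<forall>h\<in>H. \<forall>\<xi>. h \<xi> \<le> f \<xi>" by auto
    then show ?case
      using insert.prems
      by (intro bexI[of _ "\<lambda>\<xi>. max (h \<xi>) (f \<xi>)"] below_max) (auto simp: le_max_iff_disj)
  qed (use ne in auto)
  then obtain f where f: "f \<in> below G" "\<And>h \<xi>. h \<in> H \<Longrightarrow> h \<xi> \<le> f \<xi>" by blast
  have "deficit G f (s, c) \<subseteq> ?O - C"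
  proof
    fix \<zeta> assume \<zeta>: "\<zeta> \<in> deficit G f (s, c)"
    have "\<zeta> \<notin> C"
    proof
      assume "\<zeta> \<in> C"
      then obtain h where h: "h \<in> H" "c < h (s \<zeta>)" using \<F>(3) H(3) by blast
      then have "c < f (s \<zeta>)" using f(2)[OF h(1), of "s \<zeta>"] by linarith
      then show False using \<zeta> by (simp add: deficit_def)
    qed
    then show "\<zeta> \<in> ?O - C" using \<zeta> by (simp add: deficit_def)
  qed
  then have "measure \<mu> (deficit G f (s, c)) \<le> measure \<mu> (?O - C)"
    using O C(1) by (intro finite_measure_mono sets.Diff) (auto simp: sets_\<mu> sets_borel_alg_closedin)
  then show ?thesis using C(3) f(1) by (intro bexI[of _ f]) linarith+
qed

text \<open>Deficits shrink when \<open>f\<close> grows, so maxima combine the minorants found for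
  the individual levels.\<close>

lemma small_finite_deficit:
  assumes "finite S" "fst ` S \<subseteq> {p, q}" and G: "representable G" and ne: "below G \<noteq> {}" and "0 < e"
  shows "\<exists>f\<in>below G. measure \<mu> (\<Union>sc\<in>S. deficit G f sc) < e"
  using assms(1,2,5)
proof (induction S arbitrary: e)
  case empty
  then show ?case using ne by auto
next
  case (insert sc S)
  obtain s c where sc: "sc = (s, c)" by (cases sc)
  have s: "s \<in> {p, q}" using insert.prems sc by auto
  obtain f where f: "f \<in> below G" "measure \<mu> (\<Union>sc\<in>S. deficit G f sc) < e / 2"
    using insert.IH[of "e / 2"] insert.prems by auto
  obtain g where g: "g \<in> below G" "measure \<mu> (deficit G g (s, c)) < e / 2"
    using small_deficit[OF s G ne, of "e / 2" c] insert.prems by auto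
  let ?h = "\<lambda>\<xi>. max (f \<xi>) (g \<xi>)"
  have fin: "(\<Union>sc\<in>S. deficit G f sc) \<in> sets \<mu>" "deficit G g (s, c) \<in> sets \<mu>"
    using insert.hyps(1) insert.prems(1) f g s
    by (auto intro!: sets.finite_UN deficit_sets[OF _ G] simp: below_def image_subset_iff split_paired_all)
  have "(\<Union>sc\<in>insert sc S. deficit G ?h sc) \<subseteq> (\<Union>sc\<in>S. deficit G f sc) \<union> deficit G g (s, c)"
    unfolding sc deficit_def by (auto simp: le_max_iff_disj)
  then have "measure \<mu> (\<Union>sc\<in>insert sc S. deficit G ?h sc)
      \<le> measure \<mu> ((\<Union>sc\<in>S. deficit G f sc) \<union> deficit G g (s, c))"
    using fin by (intro finite_measure_mono sets.Un)
  also have "\<dots> \<le> measure \<mu> (\<Union>sc\<in>S. deficit G f sc) + measure \<mu> (deficit G g (s, c))"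
    by (rule measure_Un_le[OF fin])
  also have "\<dots> < e" using f(2) g(2) by simp
  finally show ?case using below_max[OF f(1) g(1)] by (intro bexI[of _ ?h])
qed

section \<open>One Lipschitz function that nearly attains the distance\<close>

lemma radius_bounded: "\<exists>R. \<forall>\<zeta>\<in>topspace T. \<rho> (p \<zeta>) \<le> R \<and> \<rho> (q \<zeta>) \<le> R"
proof -
  have K: "compactin T (topspace T)" using compact_T by (simp add: compact_space_def)
  have "bounded ((\<lambda>\<zeta>. \<rho> (p \<zeta>)) ` topspace T)" "bounded ((\<lambda>\<zeta>. \<rho> (q \<zeta>)) ` topspace T)"
    using image_compactin[OF K cont_p[OF radius_Lf]] image_compactin[OF K cont_q[OF radius_Lf]]
    by (simp_all add: compact_imp_bounded)
  then obtain a b where "\<And>\<zeta>. \<zeta> \<in> topspace T \<Longrightarrow> \<rho> (p \<zeta>) \<le> a" "\<And>\<zeta>. \<zeta> \<in> topspace T \<Longrightarrow> \<rho> (q \<zeta>) \<le> b"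
    by (fastforce simp: bounded_iff abs_le_iff)
  then show ?thesis
    by (intro exI[of _ "max a b"]) (auto simp: le_max_iff_disj)
qed

text \<open>At each point the potentials decrease and are bounded below, so their increments tend to
  0; continuity of \<open>\<mu>\<close> along increasing sets makes this uniform off a small
  set.\<close>

lemma potential_increment_small:
  assumes "0 < e" "0 < \<delta>"
  shows "\<exists>n. \<exists>A\<in>sets \<mu>. A \<subseteq> topspace T \<and> measure \<mu> (topspace T - A) < \<delta> \<and>
    (\<forall>\<zeta>\<in>A. potential n (p \<zeta>) - potential (Suc n) (p \<zeta>) \<le> e)"
proof -
  let ?K = "topspace T"
  define A where "A n = {\<zeta> \<in> ?K. potential n (p \<zeta>) - potential (Suc n) (p \<zeta>) \<le> e}" for n
  have meas: "(\<lambda>\<zeta>. potential n (p \<zeta>)) \<in> borel_measurable (restrict_space \<mu> ?K)" for n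
    unfolding borel_measurable_iff_greater
  proof
    fix c
    have "{\<zeta> \<in> space (restrict_space \<mu> ?K). c < potential n (p \<zeta>)} = {\<zeta> \<in> ?K. c < potential n (p \<zeta>)}"
      using sets.sets_into_space[OF topspace_T_sets] by (auto simp: space_restrict_space)
    then show "{\<zeta> \<in> space (restrict_space \<mu> ?K). c < potential n (p \<zeta>)} \<in> sets (restrict_space \<mu> ?K)"
      using openin_T_sets[OF openin_representable_greater[OF _ representable_potential, of p c n]]
        topspace_T_sets by (auto simp: sets_restrict_space_iff)
  qed
  have A: "A n \<in> sets \<mu>" for n
  proof -
    have "{\<zeta> \<in> space (restrict_space \<mu> ?K). potential n (p \<zeta>) - potential (Suc n) (p \<zeta>) \<le> e}
        \<in> sets (restrict_space \<mu> ?K)"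
      using meas[of n] meas[of "Suc n"] by measurable
    moreover have "{\<zeta> \<in> space (restrict_space \<mu> ?K). potential n (p \<zeta>) - potential (Suc n) (p \<zeta>) \<le> e} = A n"
      using sets.sets_into_space[OF topspace_T_sets] by (auto simp: space_restrict_space A_def)
    ultimately show ?thesis using topspace_T_sets by (simp add: sets_restrict_space_iff)
  qed
  \<comment> \<open>The sets \<open>A n\<close> need not increase; asking for small increments from
    \<open>n\<close> onwards produces an increasing sequence.\<close>
  define C where "C n = (\<Inter>m\<in>{n..}. A m)" for n
  have C: "C n \<in> sets \<mu>" for n unfolding C_def using A by (intro sets.countable_INT') auto
  have "\<exists>n. \<zeta> \<in> C n" if \<zeta>: "\<zeta> \<in> ?K" for \<zeta>
  proof -
    let ?u = "\<lambda>n. potential n (p \<zeta>)"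
    have "decseq ?u" using potential_Suc_le[OF p_in[OF \<zeta>]] by (intro decseq_SucI)
    then obtain l where l: "?u \<longlonglongrightarrow> l"
      using decseq_convergent[of ?u "- \<rho> (p \<zeta>)"] potential_lower[OF p_in[OF \<zeta>]] by blast
    have "(\<lambda>n. ?u n - ?u (Suc n)) \<longlonglongrightarrow> l - l"
      by (intro tendsto_diff l LIMSEQ_Suc)
    then have "\<forall>\<^sub>F n in sequentially. ?u n - ?u (Suc n) < e"
      using assms(1) by (intro order_tendstoD(2)) auto
    then show ?thesis using \<zeta> by (force simp: C_def A_def eventually_sequentially)
  qed
  moreover have "C n \<subseteq> ?K" for n by (force simp: C_def A_def)
  ultimately have "(\<Union>n. C n) = ?K" by blast
  moreover have "incseq C" unfolding C_def incseq_def by (auto intro!: INF_superset_mono)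
  ultimately have "(\<lambda>n. measure \<mu> (C n)) \<longlonglongrightarrow> measure \<mu> ?K"
    using finite_Lim_measure_incseq[of C] C by (auto simp: image_subset_iff)
  then have "\<forall>\<^sub>F n in sequentially. measure \<mu> ?K - \<delta> < measure \<mu> (C n)"
    using assms(2) by (intro order_tendstoD(1)) auto
  then obtain n where "measure \<mu> ?K - \<delta> < measure \<mu> (C n)"
    by (auto simp: eventually_sequentially)
  moreover have "measure \<mu> (?K - C n) = measure \<mu> ?K - measure \<mu> (C n)"
    using topspace_T_sets C \<open>C n \<subseteq> ?K\<close> by (intro finite_measure_Diff)
  ultimately have "measure \<mu> (?K - C n) < \<delta>" by simp
  then show ?thesis
    using C \<open>C n \<subseteq> ?K\<close> by (intro exI[of _ n] bexI[of _ "C n"]) (auto simp: C_def A_def)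
qed

text \<open>Half of \<open>e\<close> pays for replacing the potential at \<open>p \<zeta>\<close> by
  a minorant, the other half for the increment in \<open>potential_step\<close>. At
  \<open>q \<zeta>\<close> the minorant errs in the favourable direction.\<close>

lemma attains_D_in_measure:
  assumes e: "0 < e" and \<delta>: "0 < \<delta>"
  shows "\<exists>f\<in>Lf. \<exists>A\<in>sets \<mu>. A \<subseteq> topspace T \<and> measure \<mu> (topspace T - A) < \<delta> \<and>
    (\<forall>\<zeta>\<in>A. D \<zeta> - e \<le> f (p \<zeta>) - f (q \<zeta>))"
proof (cases "topspace T = {}")
  case True
  then show ?thesis using radius_Lf \<delta> by (intro bexI[of _ \<rho>] bexI[of _ "{}"]) auto
next
  case False
  then obtain \<zeta>0 where \<zeta>0: "\<zeta>0 \<in> topspace T" by blast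
  let ?K = "topspace T" and ?e = "e / 2"
  obtain n B where B: "B \<in> sets \<mu>" "B \<subseteq> ?K" "measure \<mu> (?K - B) < \<delta> / 2"
    "\<And>\<zeta>. \<zeta> \<in> B \<Longrightarrow> potential n (p \<zeta>) - potential (Suc n) (p \<zeta>) \<le> ?e"
    using potential_increment_small[of ?e "\<delta> / 2"] e \<delta> by auto
  let ?G = "potential (Suc n)"
  note G = representable_potential[of "Suc n"]
  obtain R where R: "\<And>\<zeta>. \<zeta> \<in> ?K \<Longrightarrow> \<rho> (p \<zeta>) \<le> R \<and> \<rho> (q \<zeta>) \<le> R"
    using radius_bounded by blast
  \<comment> \<open>Levels with mesh \<open>e / 2\<close> must cover the range of the potential,
    which lies between \<open>- R\<close> and \<open>R\<close>; the extra 1 absorbs the shift in the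
    choice of \<open>j\<close> below.\<close>
  obtain N :: nat where N: "R / ?e + 1 < real N" using reals_Archimedean2 by blast
  let ?S = "{p, q} \<times> (\<lambda>j. ?e * real_of_int j) ` {- int N..int N}"
  have "?G (p \<zeta>0) - 1 < ?G (p \<zeta>0)" by simp
  then have "below ?G \<noteq> {}" using G p_in[OF \<zeta>0] unfolding representable_def by (metis empty_iff)
  then obtain f where f: "f \<in> below ?G" "measure \<mu> (\<Union>sc\<in>?S. deficit ?G f sc) < \<delta> / 2"
    using small_finite_deficit[OF _ _ G, of ?S "\<delta> / 2"] \<delta> by auto
  let ?N = "\<Union>sc\<in>?S. deficit ?G f sc"
  have Nsets: "?N \<in> sets \<mu>"
    using f(1) by (intro sets.finite_UN) (auto intro!: deficit_sets[OF _ G] simp: below_def)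
  have close: "?G (s \<zeta>) - ?e \<le> f (s \<zeta>)" if s: "s \<in> {p, q}" and \<zeta>: "\<zeta> \<in> ?K" "\<zeta> \<notin> ?N" for s \<zeta>
  proof -
    \<comment> \<open>The largest integer strictly below the quotient: \<open>deficit\<close>
      requires the potential to exceed the level strictly.\<close>
    define j where "j = \<lceil>?G (s \<zeta>) / ?e\<rceil> - 1"
    have j: "real_of_int j < ?G (s \<zeta>) / ?e" "?G (s \<zeta>) / ?e \<le> real_of_int j + 1"
      unfolding j_def by linarith+
    have in_E: "s \<zeta> \<in> E" and "\<rho> (s \<zeta>) \<le> R" using s p_in q_in R \<zeta>(1) by auto
    then have "\<bar>?G (s \<zeta>)\<bar> \<le> R" using potential_lower[OF in_E, of "Suc n"] potential_upper[OF in_E, of "Suc n"] by linarith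
    then have "- R \<le> ?G (s \<zeta>)" "?G (s \<zeta>) \<le> R" by linarith+
    moreover have "0 \<le> ?e" using e by simp
    ultimately have "- R / ?e \<le> ?G (s \<zeta>) / ?e" "?G (s \<zeta>) / ?e \<le> R / ?e"
      by - (rule divide_right_mono; assumption)+
    moreover have "- R / ?e = - (R / ?e)" by simp
    ultimately have "j \<in> {- int N..int N}" using N j unfolding atLeastAtMost_iff by linarith
    then have "(s, ?e * real_of_int j) \<in> ?S" using s by blast
    then have "\<zeta> \<notin> deficit ?G f (s, ?e * real_of_int j)" using \<zeta>(2) by blast
    moreover have "?e * real_of_int j < ?G (s \<zeta>)" "?G (s \<zeta>) - ?e \<le> ?e * real_of_int j"
      using j e by (simp_all add: field_simps)
    ultimately show ?thesis using \<zeta>(1) by (auto simp: deficit_def)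
  qed
  show ?thesis
  proof (intro bexI conjI ballI)
    show "B - ?N \<in> sets \<mu>" "f \<in> Lf" "B - ?N \<subseteq> ?K" using B Nsets f(1) by (auto simp: below_def)
    have "measure \<mu> (?K - (B - ?N)) \<le> measure \<mu> ((?K - B) \<union> ?N)"
      using B(1) Nsets topspace_T_sets by (intro finite_measure_mono) auto
    also have "\<dots> \<le> measure \<mu> (?K - B) + measure \<mu> ?N"
      using B(1) Nsets topspace_T_sets by (intro measure_Un_le) auto
    finally show "measure \<mu> (?K - (B - ?N)) < \<delta>" using B(3) f(2) by simp
    fix \<zeta> assume \<zeta>: "\<zeta> \<in> B - ?N"
    then have K: "\<zeta> \<in> ?K" using B(2) by blast
    have "?G (p \<zeta>) - ?e \<le> f (p \<zeta>)" using close[of p \<zeta>] \<zeta> K by blast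
    moreover have "f (q \<zeta>) \<le> ?G (q \<zeta>)" using f(1) q_in[OF K] by (simp add: below_def)
    moreover have "?G (q \<zeta>) \<le> potential n (p \<zeta>) - D \<zeta>"
      using potential_step[OF K q_in[OF K], of n] dm_self[OF q_in[OF K]] by simp
    moreover have "potential n (p \<zeta>) - ?G (p \<zeta>) \<le> ?e" using B(4) \<zeta> by blast
    ultimately show "D \<zeta> - e \<le> f (p \<zeta>) - f (q \<zeta>)" by simp
  qed
qed

end


section \<open>Points of the Stone-Cech compactification over the realcompactification\<close>

abbreviation tr_B :: "'a::metric_space dl_point \<Rightarrow> ('a \<times> 'a) filter" where
  "tr_B \<equiv> trace_filter offdiag (bounded_cont offdiag)"

lemma beta_offdiag_eq: "beta_offdiag = eval_closure offdiag (bounded_cont offdiag)"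
  by (simp add: beta_offdiag_def stone_cech_def)

lemma dense_beta_offdiag: "beta_offdiag closure_of (emb_offdiag ` offdiag) = topspace beta_offdiag"
  unfolding beta_offdiag_eq emb_offdiag_def by (rule dense_eval_closure)

lemma emb_offdiag_in: "emb_offdiag ` offdiag \<subseteq> topspace beta_offdiag"
  unfolding beta_offdiag_eq emb_offdiag_def by (auto intro: eval_emb_topspace)

section \<open>Coordinate maps between the compactifications\<close>

lemma bounded_ucont_coordinate:
  assumes "h \<in> bounded_ucont" "continuous_on UNIV c"
  shows "(\<lambda>w. h (c w)) \<in> bounded_cont S"
  using assms unfolding bounded_ucont_def bounded_cont_def
  by (auto intro!: continuous_on_compose2[OF uniformly_continuous_imp_continuous, of UNIV h]
      intro: continuous_on_subset bounded_subset)

text \<open>Points are functions on generating families, so the extension of a continuous coordinate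
  map is precomposition with it.\<close>

definition coord_ext :: "('a::metric_space \<times> 'a \<Rightarrow> 'a) \<Rightarrow> 'a dl_point \<Rightarrow> 'a u_point" where
  "coord_ext c \<zeta> = (\<lambda>h\<in>bounded_ucont. \<zeta> (\<lambda>w. h (c w)))"

lemma coord_ext_emb:
  assumes "continuous_on UNIV (c :: 'a::metric_space \<times> 'a \<Rightarrow> 'a)"
  shows "coord_ext c (emb_offdiag w) = emb_samuel (c w)"
proof
  fix h
  show "coord_ext c (emb_offdiag w) h = emb_samuel (c w) h"
    using bounded_ucont_coordinate[OF _ assms, of h offdiag]
    by (simp add: coord_ext_def emb_offdiag_def emb_samuel_def eval_emb_def restrict_def)
qed

text \<open>Each coordinate is an evaluation; density of \<open>offdiag\<close> keeps the image
  inside the closure that defines \<open>samuel\<close>.\<close>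

lemma continuous_map_coord_ext:
  assumes c: "continuous_on UNIV (c :: 'a::metric_space \<times> 'a \<Rightarrow> 'a)"
  shows "continuous_map beta_offdiag samuel (coord_ext c)"
proof -
  let ?P = "product_topology (\<lambda>_. euclideanreal) (bounded_ucont :: ('a \<Rightarrow> real) set)"
  have "continuous_map beta_offdiag euclideanreal (\<lambda>\<zeta>. coord_ext c \<zeta> h)" if "h \<in> bounded_ucont" for h
    using continuous_map_eval[OF bounded_ucont_coordinate[OF that c], of offdiag] that
    by (simp add: coord_ext_def beta_offdiag_eq)
  then have cont: "continuous_map beta_offdiag ?P (coord_ext c)"
    by (auto simp: continuous_map_componentwise coord_ext_def)
  have "coord_ext c ` emb_offdiag ` offdiag \<subseteq> range emb_samuel"
    by (auto simp: coord_ext_emb[OF c])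
  then have "coord_ext c ` topspace beta_offdiag \<subseteq> ?P closure_of range emb_samuel"
    using continuous_map_image_closure_subset[OF cont, of "emb_offdiag ` offdiag"]
      closure_of_mono[of "coord_ext c ` emb_offdiag ` offdiag" "range emb_samuel" ?P]
    by (simp add: dense_beta_offdiag)
  then show ?thesis
    using cont unfolding samuel_def eval_closure_def emb_samuel_def
    by (auto simp: continuous_map_in_subtopology)
qed

lemma cont_ext_coord:
  assumes c: "continuous_on UNIV (c :: 'a::metric_space \<times> 'a \<Rightarrow> 'a)"
  shows "cont_ext beta_offdiag emb_offdiag offdiag samuel (\<lambda>w. emb_samuel (c w)) =
    restrict (coord_ext c) (topspace beta_offdiag)"
proof (rule cont_ext_eqI[OF dense_beta_offdiag samuel_compactification(2) continuous_map_coord_ext[OF c] _ emb_offdiag_in])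
  show "coord_ext c (emb_offdiag w) = emb_samuel (c w)" for w by (rule coord_ext_emb[OF c])
qed

lemma proj1_eq: "\<zeta> \<in> topspace beta_offdiag \<Longrightarrow> proj1 \<zeta> = coord_ext fst \<zeta>"
  unfolding proj1_def case_prod_unfold cont_ext_coord[OF continuous_on_fst[OF continuous_on_id]]
  by simp

lemma proj2_eq: "\<zeta> \<in> topspace beta_offdiag \<Longrightarrow> proj2 \<zeta> = coord_ext snd \<zeta>"
  unfolding proj2_def case_prod_unfold cont_ext_coord[OF continuous_on_snd[OF continuous_on_id]]
  by simp

lemma continuous_map_proj1: "continuous_map beta_offdiag samuel proj1"
  by (rule continuous_map_eq[OF continuous_map_coord_ext[of fst]])
    (auto intro!: continuous_intros simp: proj1_eq)

lemma continuous_map_proj2: "continuous_map beta_offdiag samuel proj2"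
  by (rule continuous_map_eq[OF continuous_map_coord_ext[of snd]])
    (auto intro!: continuous_intros simp: proj2_eq)

lemma coord_ext_tendsto:
  assumes c: "continuous_on UNIV c" and \<zeta>: "\<zeta> \<in> topspace beta_offdiag"
    and "coord_ext c \<zeta> \<in> M_R z" "L-lipschitz_on UNIV f"
  shows "((\<lambda>w. f (c w)) \<longlongrightarrow> delta_R (coord_ext c \<zeta>) f) (tr_B \<zeta>)"
proof -
  let ?h = "\<lambda>x. arctan (f x)" and ?t = "coord_ext c \<zeta> (\<lambda>x. arctan (f x))"
  note h = arctan_lipschitz_ucont[OF assms(4)]
  have lim: "((\<lambda>w. ?h (c w)) \<longlongrightarrow> ?t) (tr_B \<zeta>)"
    using tendsto_trace_filter[OF _ bounded_ucont_coordinate[OF h c], of \<zeta> offdiag] \<zeta> h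
    by (simp add: coord_ext_def beta_offdiag_eq)
  have "\<bar>?t\<bar> < pi / 2" by (rule delta_R_eq(2)[OF assms(3,4)])
  then have "cos ?t \<noteq> 0" using cos_gt_zero_pi[of ?t] by linarith
  from isCont_tendsto_compose[OF isCont_tan[OF this] lim] show ?thesis
    unfolding delta_R_eq(1)[OF assms(3,4)] by (simp add: tan_arctan)
qed

text \<open>Named because it indexes a coordinate: for 1-Lipschitz \<open>f\<close> the extended
  quotient at \<open>\<zeta>\<close> is just \<open>\<zeta> (slope f)\<close>.\<close>

definition slope :: "('a::metric_space \<Rightarrow> real) \<Rightarrow> 'a \<times> 'a \<Rightarrow> real" where
  "slope f = (\<lambda>(x, y). (f x - f y) / dist x y)"

lemma slope_le: "1-lipschitz_on UNIV f \<Longrightarrow> \<bar>slope f w\<bar> \<le> 1"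
  by (cases w) (auto simp: slope_def lipschitz_on_def dist_real_def divide_le_eq)

lemma slope_bounded_cont:
  assumes "1-lipschitz_on UNIV f"
  shows "slope f \<in> bounded_cont offdiag"
proof -
  have f: "continuous_on UNIV f" by (rule lipschitz_on_continuous_on[OF assms])
  have "continuous_on offdiag (slope f)"
    unfolding slope_def case_prod_unfold
    by (intro continuous_intros continuous_on_compose2[OF f]) (auto simp: offdiag_def)
  moreover have "bounded (slope f ` offdiag)"
    using slope_le[OF assms] by (intro boundedI[of _ 1]) auto
  ultimately show ?thesis by (simp add: bounded_cont_def)
qed

lemma de_leeuw_eq:
  "1-lipschitz_on UNIV f \<Longrightarrow> \<zeta> \<in> topspace beta_offdiag \<Longrightarrow> de_leeuw f \<zeta> = \<zeta> (slope f)"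
  using cont_ext_eval[OF slope_bounded_cont, of f \<zeta>]
  by (simp add: de_leeuw_def beta_offdiag_eq emb_offdiag_def slope_def)

lemma de_leeuw_tendsto:
  assumes "1-lipschitz_on UNIV f" "\<zeta> \<in> topspace beta_offdiag"
  shows "(slope f \<longlongrightarrow> de_leeuw f \<zeta>) (tr_B \<zeta>)"
  unfolding de_leeuw_eq[OF assms] using assms(2)
  by (intro tendsto_trace_filter slope_bounded_cont[OF assms(1)]) (simp add: beta_offdiag_eq)

lemma tr_B_neq_bot: "\<zeta> \<in> topspace beta_offdiag \<Longrightarrow> tr_B \<zeta> \<noteq> bot"
  by (rule trace_filter_neq_bot) (simp add: beta_offdiag_eq)

lemma abs_de_leeuw_le:
  assumes "1-lipschitz_on UNIV f" "\<zeta> \<in> topspace beta_offdiag"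
  shows "\<bar>de_leeuw f \<zeta>\<bar> \<le> 1"
  by (rule tendsto_upperbound[OF tendsto_rabs[OF de_leeuw_tendsto[OF assms]] _ tr_B_neq_bot[OF assms(2)]])
    (simp add: slope_le[OF assms(1)])

lemma continuous_map_de_leeuw:
  "1-lipschitz_on UNIV f \<Longrightarrow> continuous_map beta_offdiag euclideanreal (de_leeuw f)"
  by (rule continuous_map_eq[of _ _ "\<lambda>\<zeta>. \<zeta> (slope f)"])
    (auto simp: de_leeuw_eq beta_offdiag_eq[symmetric] intro: continuous_map_eval[OF slope_bounded_cont, of f offdiag, folded beta_offdiag_eq])

lemma borel_measurable_continuous_map:
  assumes "continuous_map X euclideanreal h"
  shows "h \<in> borel_measurable (borel_alg X)"
proof (rule borel_measurableI)
  fix U :: "real set" assume "open U"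
  then have "openin X {x \<in> topspace X. h x \<in> U}"
    using assms by (intro openin_continuous_map_preimage) auto
  moreover have "h -` U \<inter> space (borel_alg X) = {x \<in> topspace X. h x \<in> U}"
    by (auto simp: space_borel_alg)
  ultimately show "h -` U \<inter> space (borel_alg X) \<in> sets (borel_alg X)"
    using sets_borel_alg_openin by metis
qed

lemma de_leeuw_uminus:
  assumes "1-lipschitz_on UNIV f" "\<zeta> \<in> topspace beta_offdiag"
  shows "de_leeuw (\<lambda>x. - f x) \<zeta> = - de_leeuw f \<zeta>"
proof (rule tendsto_unique[OF tr_B_neq_bot[OF assms(2)] de_leeuw_tendsto[OF lipschitz_uminus[OF assms(1)] assms(2)]])
  have "slope (\<lambda>x. - f x) = (\<lambda>w. - slope f w)"
    by (auto simp: slope_def fun_eq_iff minus_divide_left)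
  then show "(slope (\<lambda>x. - f x) \<longlongrightarrow> - de_leeuw f \<zeta>) (tr_B \<zeta>)"
    using tendsto_minus[OF de_leeuw_tendsto[OF assms]] by simp
qed

text \<open>On \<open>R_plus z\<close> this is the continuous extension of the metric: since both coordinates stay
  at bounded distance from \<open>z\<close>, the extension of \<open>arctan \<circ> dist\<close> does not reach \<open>pi / 2\<close>.\<close>

definition gap :: "'a::metric_space dl_point \<Rightarrow> real" where
  "gap \<zeta> = tan (\<zeta> (\<lambda>w. arctan (dist (fst w) (snd w))))"

section \<open>The gap and optimal points\<close>

lemma R_plusD:
  assumes "\<zeta> \<in> R_plus z"
  shows "\<zeta> \<in> topspace beta_offdiag" "proj1 \<zeta> \<in> M_R z" "proj2 \<zeta> \<in> M_R z" "proj1 \<zeta> \<noteq> proj2 \<zeta>"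
  using assms by (auto simp: R_plus_def)

lemma proj1_tendsto:
  assumes "\<zeta> \<in> R_plus z" "L-lipschitz_on UNIV f"
  shows "((\<lambda>w. f (fst w)) \<longlongrightarrow> delta_R (proj1 \<zeta>) f) (tr_B \<zeta>)"
  using coord_ext_tendsto[of fst \<zeta> z L f] R_plusD[OF assms(1)] assms(2)
  by (simp add: proj1_eq continuous_on_fst)

lemma proj2_tendsto:
  assumes "\<zeta> \<in> R_plus z" "L-lipschitz_on UNIV f"
  shows "((\<lambda>w. f (snd w)) \<longlongrightarrow> delta_R (proj2 \<zeta>) f) (tr_B \<zeta>)"
  using coord_ext_tendsto[of snd \<zeta> z L f] R_plusD[OF assms(1)] assms(2)
  by (simp add: proj2_eq continuous_on_snd)

lemma arctan_dist_bounded_cont: "(\<lambda>w. arctan (dist (fst w) (snd w))) \<in> bounded_cont S"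
proof -
  have "bounded ((\<lambda>w. arctan (dist (fst w) (snd w))) ` S)"
    using abs_arctan_less by (intro boundedI[of _ "pi / 2"]) (auto intro: less_imp_le)
  then show ?thesis by (auto simp: bounded_cont_def intro!: continuous_intros)
qed

lemma dist_eventually_bounded:
  assumes "\<zeta> \<in> R_plus z"
  shows "\<exists>B. \<forall>\<^sub>F w in tr_B \<zeta>. \<bar>dist (fst w) (snd w)\<bar> \<le> B"
proof -
  let ?a = "delta_R (proj1 \<zeta>) (\<lambda>x. dist x z)" and ?b = "delta_R (proj2 \<zeta>) (\<lambda>x. dist x z)"
  have "\<forall>\<^sub>F w in tr_B \<zeta>. dist (fst w) z < ?a + 1"
    using order_tendstoD(2)[OF proj1_tendsto[OF assms dist_lipschitz[of z]], of "?a + 1"] by simp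
  moreover have "\<forall>\<^sub>F w in tr_B \<zeta>. dist (snd w) z < ?b + 1"
    using order_tendstoD(2)[OF proj2_tendsto[OF assms dist_lipschitz[of z]], of "?b + 1"] by simp
  ultimately have "\<forall>\<^sub>F w in tr_B \<zeta>. \<bar>dist (fst w) (snd w)\<bar> \<le> ?a + ?b + 2"
  proof eventually_elim
    case (elim w)
    then show ?case using dist_triangle2[of "fst w" "snd w" z] by simp
  qed
  then show ?thesis ..
qed

lemma
  assumes "\<zeta> \<in> R_plus z"
  shows gap_tendsto: "((\<lambda>w. dist (fst w) (snd w)) \<longlongrightarrow> gap \<zeta>) (tr_B \<zeta>)"
    and abs_arctan_gap: "\<bar>\<zeta> (\<lambda>w. arctan (dist (fst w) (snd w)))\<bar> < pi / 2"
proof -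
  obtain B where B: "\<forall>\<^sub>F w in tr_B \<zeta>. \<bar>dist (fst w) (snd w)\<bar> \<le> B"
    using dist_eventually_bounded[OF assms] by blast
  have \<zeta>: "\<zeta> \<in> topspace (eval_closure offdiag (bounded_cont offdiag))"
    using R_plusD(1)[OF assms] by (simp add: beta_offdiag_eq)
  show "((\<lambda>w. dist (fst w) (snd w)) \<longlongrightarrow> gap \<zeta>) (tr_B \<zeta>)"
    unfolding gap_def by (rule tendsto_tan_trace_filter(2)[OF \<zeta> arctan_dist_bounded_cont B])
  show "\<bar>\<zeta> (\<lambda>w. arctan (dist (fst w) (snd w)))\<bar> < pi / 2"
    by (rule tendsto_tan_trace_filter(1)[OF \<zeta> arctan_dist_bounded_cont B])
qed

text \<open>The identity \<open>slope f w * dist (fst w) (snd w) = f (fst w) - f (snd w)\<close> on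
  \<open>offdiag\<close> passes to the limit, since over \<open>R_plus z\<close> all the terms have
  finite limits.\<close>

lemma de_leeuw_gap:
  assumes "\<zeta> \<in> R_plus z" "1-lipschitz_on UNIV f"
  shows "delta_R (proj1 \<zeta>) f - delta_R (proj2 \<zeta>) f = de_leeuw f \<zeta> * gap \<zeta>"
proof (rule tendsto_unique[OF tr_B_neq_bot[OF R_plusD(1)[OF assms(1)]]])
  show "((\<lambda>w. f (fst w) - f (snd w)) \<longlongrightarrow> delta_R (proj1 \<zeta>) f - delta_R (proj2 \<zeta>) f) (tr_B \<zeta>)"
    by (intro tendsto_diff proj1_tendsto[OF assms] proj2_tendsto[OF assms])
  have "((\<lambda>w. slope f w * dist (fst w) (snd w)) \<longlongrightarrow> de_leeuw f \<zeta> * gap \<zeta>) (tr_B \<zeta>)"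
    by (intro tendsto_mult gap_tendsto[OF assms(1)] de_leeuw_tendsto[OF assms(2)] R_plusD(1)[OF assms(1)])
  then show "((\<lambda>w. f (fst w) - f (snd w)) \<longlongrightarrow> de_leeuw f \<zeta> * gap \<zeta>) (tr_B \<zeta>)"
    by (rule Lim_transform_eventually)
      (auto intro!: eventually_mono[OF eventually_trace_filter_in] simp: slope_def offdiag_def)
qed

text \<open>Distinct coordinates are separated by an extended Lipschitz function, whose difference
  would vanish if the gap did.\<close>

lemma gap_pos:
  assumes "\<zeta> \<in> R_plus z"
  shows "0 < gap \<zeta>"
proof -
  have "0 \<le> gap \<zeta>"
    by (rule tendsto_lowerbound[OF gap_tendsto[OF assms] _ tr_B_neq_bot[OF R_plusD(1)[OF assms]]]) simp
  moreover obtain f where f: "1-lipschitz_on UNIV f" "delta_R (proj1 \<zeta>) f \<noteq> delta_R (proj2 \<zeta>) f"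
    using delta_R_separates[OF R_plusD(2-4)[OF assms]] by blast
  then have "gap \<zeta> \<noteq> 0" using de_leeuw_gap[OF assms f(1)] by auto
  ultimately show ?thesis by simp
qed

lemma dist_R_abs_upper:
  assumes "\<xi> \<in> M_R z" "\<eta> \<in> M_R z" "1-lipschitz_on UNIV f"
  shows "\<bar>delta_R \<xi> f - delta_R \<eta> f\<bar> \<le> dist_R z \<xi> \<eta>"
  using dist_R_upper[OF assms] dist_R_upper[OF assms(2,1,3)] dist_R_commute[of z \<xi> \<eta>] by linarith

lemma dist_R_le_gap:
  assumes "\<zeta> \<in> R_plus z"
  shows "dist_R z (proj1 \<zeta>) (proj2 \<zeta>) \<le> gap \<zeta>"
  unfolding dist_R_def
proof (rule dual_norm_least)
  fix f :: "'a \<Rightarrow> real" assume f: "1-lipschitz_on UNIV f"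
  show "\<bar>delta_R (proj1 \<zeta>) f - delta_R (proj2 \<zeta>) f\<bar> \<le> gap \<zeta>"
    unfolding de_leeuw_gap[OF assms f]
    using abs_de_leeuw_le[OF f R_plusD(1)[OF assms]] gap_pos[OF assms]
    by (simp add: abs_mult mult_left_le_one_le)
qed

text \<open>By \<open>de_leeuw_gap\<close>, the distance of the coordinates is the norm of
  evaluation at \<open>\<zeta>\<close> times the positive gap.\<close>

lemma optimal_iff_gap:
  assumes "\<zeta> \<in> R_plus z"
  shows "\<zeta> \<in> optimal_points z \<longleftrightarrow> dist_R z (proj1 \<zeta>) (proj2 \<zeta>) = gap \<zeta>"
proof -
  note \<zeta> = R_plusD[OF assms]
  let ?N = "dual_norm z (\<lambda>f. de_leeuw f \<zeta>)" and ?d = "dist_R z (proj1 \<zeta>) (proj2 \<zeta>)"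
  have "de_leeuw_adj (return (borel_alg beta_offdiag) \<zeta>) f = de_leeuw f \<zeta>" if "1-lipschitz_on UNIV f" for f
    unfolding de_leeuw_adj_def
    by (rule integral_return)
      (use \<zeta>(1) borel_measurable_continuous_map[OF continuous_map_de_leeuw[OF that]] in \<open>auto simp: space_borel_alg\<close>)
  then have "dual_norm z (de_leeuw_adj (return (borel_alg beta_offdiag) \<zeta>)) = ?N"
    by (intro dual_norm_cong)
  then have opt: "\<zeta> \<in> optimal_points z \<longleftrightarrow> ?N = 1"
    using \<zeta>(1) by (simp add: optimal_points_def)
  have pos: "0 < gap \<zeta>" by (rule gap_pos[OF assms])
  have "?d \<le> ?N * gap \<zeta>"
    unfolding dist_R_def
  proof (rule dual_norm_least)
    fix f :: "'a \<Rightarrow> real" assume f: "f z = 0" "1-lipschitz_on UNIV f"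
    have "\<bar>de_leeuw f \<zeta>\<bar> \<le> ?N"
      by (rule dual_norm_upper[OF _ f]) (rule abs_de_leeuw_le[OF _ \<zeta>(1)])
    then show "\<bar>delta_R (proj1 \<zeta>) f - delta_R (proj2 \<zeta>) f\<bar> \<le> ?N * gap \<zeta>"
      unfolding de_leeuw_gap[OF assms f(2)] using pos by (simp add: abs_mult)
  qed
  moreover have "?N \<le> ?d / gap \<zeta>"
  proof (rule dual_norm_least)
    fix f :: "'a \<Rightarrow> real" assume f: "1-lipschitz_on UNIV f"
    show "\<bar>de_leeuw f \<zeta>\<bar> \<le> ?d / gap \<zeta>"
      using dist_R_abs_upper[OF \<zeta>(2,3) f] pos unfolding de_leeuw_gap[OF assms f]
      by (simp add: abs_mult pos_le_divide_eq)
  qed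
  ultimately have "?d = ?N * gap \<zeta>" using pos by (simp add: pos_le_divide_eq)
  then show ?thesis using opt pos by simp
qed


section \<open>Optimal measures\<close>

lemma radon_posD:
  assumes "\<mu> \<in> radon_pos X"
  shows "finite_measure \<mu>" "sets \<mu> = sets (borel_alg X)" "space \<mu> = topspace X"
    "A \<in> sets \<mu> \<Longrightarrow> 0 < e \<Longrightarrow> \<exists>C. closedin X C \<and> C \<subseteq> A \<and> measure \<mu> (A - C) < e"
  using assms sets_eq_imp_space_eq[of \<mu> "borel_alg X"] by (auto simp: radon_pos_def space_borel_alg)

lemma integrable_de_leeuw:
  assumes "\<mu> \<in> radon_pos beta_offdiag" "1-lipschitz_on UNIV f"
  shows "integrable \<mu> (de_leeuw f)"
proof -
  interpret finite_measure \<mu> by (rule radon_posD[OF assms(1)])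
  show ?thesis
    using abs_de_leeuw_le[OF assms(2)] borel_measurable_continuous_map[OF continuous_map_de_leeuw[OF assms(2)]]
    by (intro integrable_const_bound[of _ 1])
      (auto simp: radon_posD(3)[OF assms(1)] measurable_cong_sets[OF radon_posD(2)[OF assms(1)] refl])
qed

lemma abs_de_leeuw_adj_le:
  assumes "\<mu> \<in> radon_pos beta_offdiag" "1-lipschitz_on UNIV f"
  shows "\<bar>de_leeuw_adj \<mu> f\<bar> \<le> measure \<mu> (space \<mu>)"
proof -
  interpret finite_measure \<mu> by (rule radon_posD[OF assms(1)])
  have "\<bar>de_leeuw_adj \<mu> f\<bar> \<le> (\<integral>\<zeta>. \<bar>de_leeuw f \<zeta>\<bar> \<partial>\<mu>)"
    unfolding de_leeuw_adj_def by (rule integral_abs_bound)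
  also have "\<dots> \<le> (\<integral>\<zeta>. 1 \<partial>\<mu>)"
    using integrable_de_leeuw[OF assms] abs_de_leeuw_le[OF assms(2)]
    by (intro integral_mono) (auto simp: radon_posD(3)[OF assms(1)])
  finally show ?thesis by simp
qed

text \<open>The reverse inequality always holds because transforms of 1-Lipschitz functions are
  bounded by 1.\<close>

lemma M_op_iff:
  assumes "\<mu> \<in> radon_pos beta_offdiag"
  shows "\<mu> \<in> M_op z \<longleftrightarrow> measure \<mu> (space \<mu>) \<le> dual_norm z (de_leeuw_adj \<mu>)"
  using assms dual_norm_least[of z "de_leeuw_adj \<mu>", OF abs_de_leeuw_adj_le[OF assms]]
    total_variation_eq[OF radon_posD(1)[OF assms]]
  by (auto simp: M_op_def)


section \<open>Concentration and maximising sequences\<close>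

lemma concentrated_on_Diff_null:
  assumes "concentrated_on \<mu> S" "N \<in> null_sets \<mu>"
  shows "concentrated_on \<mu> (S - N)"
proof -
  have N: "N \<in> null_sets (completion \<mu>)" by (rule null_sets_completionI[OF assms(2)])
  have S: "S \<in> sets (completion \<mu>)" "space \<mu> - S \<in> null_sets (completion \<mu>)"
    using assms(1) sets.compl_sets[of S "completion \<mu>"] by (auto simp: concentrated_on_def)
  then have "S - N \<in> sets (completion \<mu>)" using N by auto
  moreover have "space \<mu> - (S - N) \<in> null_sets (completion \<mu>)"
  proof (rule null_sets_subset)
    show "(space \<mu> - S) \<union> N \<in> null_sets (completion \<mu>)" using S N by blast
    show "space \<mu> - (S - N) \<in> sets (completion \<mu>)"
      using sets.compl_sets[OF calculation] by simp
  qed auto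
  ultimately show ?thesis by (auto simp: concentrated_on_def)
qed

text \<open>Replaces a set measurable for the completion by a Borel subset of full measure, to which
  regularity applies.\<close>

lemma concentrated_on_inner:
  assumes "concentrated_on \<mu> S"
  shows "\<exists>A\<in>sets \<mu>. A \<subseteq> S \<and> measure \<mu> (space \<mu> - A) = 0"
proof -
  have "space \<mu> - S \<in> null_sets (completion \<mu>)"
    using assms sets.compl_sets[of S "completion \<mu>"] by (auto simp: concentrated_on_def)
  then obtain N where N: "N \<in> null_sets \<mu>" "space \<mu> - S \<subseteq> N"
    by (auto simp: null_sets_completion_iff2)
  have "space \<mu> - (space \<mu> - N) = N" using sets.sets_into_space[OF null_setsD2[OF N(1)]] by auto
  then have "measure \<mu> (space \<mu> - (space \<mu> - N)) = 0" using N(1) by (simp add: measure_eq_0_null_sets)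
  then show ?thesis using N by (intro bexI[of _ "space \<mu> - N"]) auto
qed

text \<open>The transforms are at most \<open>1\<close>, so convergence of their integrals to the total mass is
  convergence to \<open>1\<close> in mean.\<close>

lemma maximising_sequence:
  assumes \<mu>: "\<mu> \<in> radon_pos beta_offdiag" and op: "\<mu> \<in> M_op z"
  shows "\<exists>f. (\<forall>n. f n z = 0 \<and> 1-lipschitz_on UNIV (f n)) \<and>
    (AE \<zeta> in \<mu>. (\<lambda>n. de_leeuw (f n) \<zeta>) \<longlonglongrightarrow> 1)"
proof -
  interpret finite_measure \<mu> by (rule radon_posD[OF \<mu>])
  let ?m = "measure \<mu> (space \<mu>)"
  have "\<exists>f. f z = 0 \<and> 1-lipschitz_on UNIV f \<and> ?m - 1 / real (Suc n) < de_leeuw_adj \<mu> f" for n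
  proof -
    have "?m - 1 / real (Suc n) < ?m" by simp
    also have "?m \<le> dual_norm z (de_leeuw_adj \<mu>)" using op M_op_iff[OF \<mu>] by blast
    finally obtain f where f: "f z = 0" "1-lipschitz_on UNIV f" "?m - 1 / real (Suc n) < \<bar>de_leeuw_adj \<mu> f\<bar>"
      using dual_norm_approx by blast
    \<comment> \<open>Changing the sign of \<open>f\<close> if necessary removes the absolute
      value.\<close>
    have "de_leeuw_adj \<mu> (\<lambda>x. - f x) = (\<integral>\<zeta>. - de_leeuw f \<zeta> \<partial>\<mu>)"
      unfolding de_leeuw_adj_def
      by (rule Bochner_Integration.integral_cong) (auto simp: de_leeuw_uminus[OF f(2)] radon_posD(3)[OF \<mu>])
    then have "de_leeuw_adj \<mu> (\<lambda>x. - f x) = - de_leeuw_adj \<mu> f" by (simp add: de_leeuw_adj_def)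
    then show ?thesis
      using f lipschitz_uminus[OF f(2)]
      by (cases "0 \<le> de_leeuw_adj \<mu> f") (auto intro: exI[of _ f] exI[of _ "\<lambda>x. - f x"])
  qed
  then obtain f where f: "\<And>n. f n z = 0" "\<And>n. 1-lipschitz_on UNIV (f n)"
    "\<And>n. ?m - 1 / real (Suc n) < de_leeuw_adj \<mu> (f n)" by metis
  note int = integrable_de_leeuw[OF \<mu> f(2)]
  have "(\<integral>\<zeta>. norm (1 - de_leeuw (f n) \<zeta>) \<partial>\<mu>) = ?m - de_leeuw_adj \<mu> (f n)" for n
  proof -
    have "(\<integral>\<zeta>. norm (1 - de_leeuw (f n) \<zeta>) \<partial>\<mu>) = (\<integral>\<zeta>. 1 - de_leeuw (f n) \<zeta> \<partial>\<mu>)"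
    proof (rule Bochner_Integration.integral_cong[OF refl])
      show "norm (1 - de_leeuw (f n) \<zeta>) = 1 - de_leeuw (f n) \<zeta>" if "\<zeta> \<in> space \<mu>" for \<zeta>
        using abs_de_leeuw_le[OF f(2), of \<zeta> n] that by (simp add: radon_posD(3)[OF \<mu>])
    qed
    also have "\<dots> = ?m - de_leeuw_adj \<mu> (f n)"
      using int[of n] by (simp add: de_leeuw_adj_def)
    finally show ?thesis .
  qed
  moreover have "(\<lambda>n. ?m - de_leeuw_adj \<mu> (f n)) \<longlonglongrightarrow> 0"
  proof (rule tendsto_sandwich[where f = "\<lambda>_. 0" and h = "\<lambda>n. 1 / real (Suc n)"])
    show "(\<lambda>n. 1 / real (Suc n)) \<longlonglongrightarrow> 0" by (rule LIMSEQ_Suc[OF lim_1_over_n])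
    show "\<forall>\<^sub>F n in sequentially. ?m - de_leeuw_adj \<mu> (f n) \<le> 1 / real (Suc n)"
      using f(3) by (intro always_eventually allI) (simp add: algebra_simps less_imp_le)
    show "\<forall>\<^sub>F n in sequentially. 0 \<le> ?m - de_leeuw_adj \<mu> (f n)"
      using abs_de_leeuw_adj_le[OF \<mu> f(2)] by (intro always_eventually allI) (simp add: abs_le_iff)
  qed simp
  ultimately have "(\<lambda>n. \<integral>\<zeta>. norm (1 - de_leeuw (f n) \<zeta>) \<partial>\<mu>) \<longlonglongrightarrow> 0" by simp
  \<comment> \<open>Convergence in mean yields convergence almost everywhere along a
    subsequence.\<close>
  then obtain r where "strict_mono r" and r: "AE \<zeta> in \<mu>. (\<lambda>n. 1 - de_leeuw (f (r n)) \<zeta>) \<longlonglongrightarrow> 0"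
    using tendsto_L1_AE_subseq[of \<mu> "\<lambda>n \<zeta>. 1 - de_leeuw (f n) \<zeta>"] int by auto
  have "AE \<zeta> in \<mu>. (\<lambda>n. de_leeuw (f (r n)) \<zeta>) \<longlonglongrightarrow> 1"
    using r
  proof eventually_elim
    case (elim \<zeta>)
    then show ?case using tendsto_diff[OF tendsto_const[of 1] elim] by simp
  qed
  then show ?thesis using f(1,2) by (intro exI[of _ "\<lambda>n. f (r n)"]) auto
qed

text \<open>The differences tend to the gap and never exceed the distance, which is itself at most
  the gap.\<close>

lemma maximising_gap:
  assumes \<zeta>: "\<zeta> \<in> R_plus z" and f: "\<And>n. 1-lipschitz_on UNIV (f n)"
    and lim: "(\<lambda>n. de_leeuw (f n) \<zeta>) \<longlonglongrightarrow> 1"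
  shows "dist_R z (proj1 \<zeta>) (proj2 \<zeta>) = gap \<zeta>"
    and "(\<lambda>n. delta_R (proj1 \<zeta>) (f n) - delta_R (proj2 \<zeta>) (f n)) \<longlonglongrightarrow> dist_R z (proj1 \<zeta>) (proj2 \<zeta>)"
proof -
  have *: "(\<lambda>n. delta_R (proj1 \<zeta>) (f n) - delta_R (proj2 \<zeta>) (f n)) \<longlonglongrightarrow> gap \<zeta>"
    unfolding de_leeuw_gap[OF \<zeta> f] using tendsto_mult_right[OF lim, of "gap \<zeta>"] by simp
  then have "gap \<zeta> \<le> dist_R z (proj1 \<zeta>) (proj2 \<zeta>)"
    by (rule LIMSEQ_le_const2) (use dist_R_upper[OF R_plusD(2,3)[OF \<zeta>] f] in blast)
  then show **: "dist_R z (proj1 \<zeta>) (proj2 \<zeta>) = gap \<zeta>" using dist_R_le_gap[OF \<zeta>] by simp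
  show "(\<lambda>n. delta_R (proj1 \<zeta>) (f n) - delta_R (proj2 \<zeta>) (f n)) \<longlonglongrightarrow> dist_R z (proj1 \<zeta>) (proj2 \<zeta>)"
    unfolding ** by (rule *)
qed

text \<open>For a fixed function, the sum of differences does not change when the second points are
  permuted. Before the permutation it tends to the sum of distances; after it, each term is at most
  a distance.\<close>

lemma cyclically_monotonic_maximising:
  assumes S: "S \<subseteq> R_plus z" and f: "\<And>n. 1-lipschitz_on UNIV (f n)"
    and lim: "\<And>\<zeta>. \<zeta> \<in> S \<Longrightarrow> (\<lambda>n. de_leeuw (f n) \<zeta>) \<longlonglongrightarrow> 1"
  shows "cyclically_monotonic (dist_R z) (proj ` S)"
  unfolding cyclically_monotonic_def
proof (intro allI impI)
  fix n :: nat and x y :: "nat \<Rightarrow> 'a u_point" and \<sigma>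
  assume xy: "\<forall>k\<in>{1..n}. (x k, y k) \<in> proj ` S" and \<sigma>: "\<sigma> permutes {1..n}"
  have in_M_R: "x k \<in> M_R z" "y k \<in> M_R z" if "k \<in> {1..n}" for k
    using bspec[OF xy that] S R_plusD(2,3)[of _ z] by (auto simp: proj_def)
  have "(\<lambda>i. delta_R (x k) (f i) - delta_R (y k) (f i)) \<longlonglongrightarrow> dist_R z (x k) (y k)" if "k \<in> {1..n}" for k
    using bspec[OF xy that] S maximising_gap(2)[OF _ f lim] by (auto simp: proj_def)
  then have "(\<lambda>i. \<Sum>k=1..n. delta_R (x k) (f i) - delta_R (y k) (f i)) \<longlonglongrightarrow> (\<Sum>k=1..n. dist_R z (x k) (y k))"
    by (rule tendsto_sum)
  then show "(\<Sum>k=1..n. dist_R z (x k) (y k)) \<le> (\<Sum>k=1..n. dist_R z (x k) (y (\<sigma> k)))"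
  proof (rule LIMSEQ_le_const2, intro exI allI impI)
    fix i
    have "(\<Sum>k=1..n. delta_R (x k) (f i) - delta_R (y k) (f i))
        = (\<Sum>k=1..n. delta_R (x k) (f i) - delta_R (y (\<sigma> k)) (f i))"
      using sum.permute[OF \<sigma>, of "\<lambda>k. delta_R (y k) (f i)"] by (simp add: sum_subtractf o_def)
    also have "\<dots> \<le> (\<Sum>k=1..n. dist_R z (x k) (y (\<sigma> k)))"
      using in_M_R permutes_in_image[OF \<sigma>] by (intro sum_mono dist_R_upper f) auto
    finally show "(\<Sum>k=1..n. delta_R (x k) (f i) - delta_R (y k) (f i)) \<le> (\<Sum>k=1..n. dist_R z (x k) (y (\<sigma> k)))" .
  qed
qed

section \<open>Sufficiency of cyclic monotonicity\<close>

lemma cyclically_monotonic_subset: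
  "cyclically_monotonic d C \<Longrightarrow> B \<subseteq> C \<Longrightarrow> cyclically_monotonic d B"
  unfolding cyclically_monotonic_def by (simp add: subset_iff)

lemma continuous_map_lip_ext_proj:
  assumes "g \<in> lip_ext z" "continuous_map beta_offdiag samuel P" "\<And>\<zeta>. \<zeta> \<in> K \<Longrightarrow> P \<zeta> \<in> M_R z"
  shows "continuous_map (subtopology beta_offdiag K) euclideanreal (\<lambda>\<zeta>. g (P \<zeta>))"
proof -
  obtain f where f: "1-lipschitz_on UNIV f" "\<And>\<xi>. \<xi> \<in> M_R z \<Longrightarrow> g \<xi> = delta_R \<xi> f"
    using assms(1) unfolding lip_ext_def by blast
  have "continuous_map (subtopology beta_offdiag K) (subtopology samuel (M_R z)) P"
    using assms(2,3) by (auto simp: continuous_map_in_subtopology continuous_map_from_subtopology)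
  from continuous_map_compose[OF this continuous_map_delta_R[OF f(1)]]
  have "continuous_map (subtopology beta_offdiag K) euclideanreal (\<lambda>\<zeta>. delta_R (P \<zeta>) f)"
    by (simp add: o_def)
  then show ?thesis by (rule continuous_map_eq) (use assms(3) f(2) in auto)
qed

lemma continuous_map_gap:
  assumes "K \<subseteq> R_plus z"
  shows "continuous_map (subtopology beta_offdiag K) euclideanreal gap"
proof -
  let ?h = "\<lambda>w. arctan (dist (fst w) (snd w))"
  have "continuous_map (subtopology beta_offdiag K) (top_of_set {- pi / 2<..<pi / 2}) (\<lambda>\<zeta>. \<zeta> ?h)"
    unfolding continuous_map_in_subtopology
  proof
    show "continuous_map (subtopology beta_offdiag K) euclideanreal (\<lambda>\<zeta>. \<zeta> ?h)"
      unfolding beta_offdiag_eq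
      by (intro continuous_map_from_subtopology continuous_map_eval arctan_dist_bounded_cont)
    have "\<zeta> ?h \<in> {- pi / 2<..<pi / 2}" if "\<zeta> \<in> K" for \<zeta>
      using abs_arctan_gap[OF subsetD[OF assms that]] unfolding abs_less_iff greaterThanLessThan_iff by linarith
    then show "(\<lambda>\<zeta>. \<zeta> ?h) \<in> topspace (subtopology beta_offdiag K) \<rightarrow> {- pi / 2<..<pi / 2}"
      by auto
  qed
  moreover have "continuous_on {- pi / 2<..<pi / 2} tan"
    using cos_gt_zero_pi by (intro continuous_intros) fastforce
  ultimately have "continuous_map (subtopology beta_offdiag K) euclideanreal (\<lambda>\<zeta>. tan (\<zeta> ?h))"
    using continuous_map_compose[of "subtopology beta_offdiag K" "top_of_set {- pi / 2<..<pi / 2}"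
        "\<lambda>\<zeta>. \<zeta> ?h" euclideanreal tan] by (simp add: o_def)
  then show ?thesis by (simp add: gap_def[abs_def])
qed

lemma compact_beta_offdiag: "compact_space beta_offdiag"
  unfolding beta_offdiag_def by (rule stone_cech_compactification)

text \<open>Allows an additive error in the gap to be divided by the gap, becoming a uniform error
  in the transform.\<close>

lemma compact_gap_lower_bound:
  assumes "K \<subseteq> R_plus z" "closedin beta_offdiag K"
  shows "\<exists>r>0. \<forall>\<zeta>\<in>K. r \<le> gap \<zeta>"
proof (cases "K = {}")
  case False
  have "compactin beta_offdiag K" by (rule closedin_compact_space[OF compact_beta_offdiag assms(2)])
  then have "compactin (subtopology beta_offdiag K) K" by (simp add: compactin_subtopology)
  then have "compact (gap ` K)"
    using image_compactin[OF _ continuous_map_gap[OF assms(1)]] by simp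
  then obtain \<zeta> where "\<zeta> \<in> K" "\<And>\<zeta>'. \<zeta>' \<in> K \<Longrightarrow> gap \<zeta> \<le> gap \<zeta>'"
    using compact_attains_inf[of "gap ` K"] False by blast
  then show ?thesis using gap_pos assms(1) by blast
qed (auto intro: exI[of _ 1])

lemma monotonic_contact_measure_proj:
  assumes \<mu>: "\<mu> \<in> radon_pos beta_offdiag" and S: "S \<subseteq> R_plus z \<inter> optimal_points z"
    and cyc: "cyclically_monotonic (dist_R z) (proj ` S)"
    and K: "closedin beta_offdiag K" "K \<subseteq> S"
  shows "monotonic_contact_measure (lip_ext z) (M_R z) (\<lambda>\<xi>. delta_R \<xi> (\<lambda>x. dist x z)) (dist_R z)
    (subtopology beta_offdiag K) proj1 proj2 gap beta_offdiag \<mu>"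
proof -
  have top: "topspace (subtopology beta_offdiag K) = K"
    using closedin_subset[OF K(1)] by auto
  have KR: "K \<subseteq> R_plus z" using K S by blast
  have PK: "\<zeta> \<in> K \<Longrightarrow> proj1 \<zeta> \<in> M_R z" "\<zeta> \<in> K \<Longrightarrow> proj2 \<zeta> \<in> M_R z" for \<zeta>
    using KR R_plusD(2,3) by blast+
  show ?thesis
  proof (intro monotonic_contact_measure.intro monotonic_contact.intro
      monotonic_contact_measure_axioms.intro, unfold top)
    show "(\<lambda>\<xi>. delta_R \<xi> (\<lambda>x. dist x z)) \<in> lip_ext z"
      unfolding lip_ext_def using dist_lipschitz by blast
    show "f \<xi> - f \<eta> \<le> dist_R z \<xi> \<eta>" if "\<xi> \<in> M_R z" "\<eta> \<in> M_R z" "f \<in> lip_ext z" for \<xi> \<eta> f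
      using that dist_R_upper unfolding lip_ext_def by fastforce
    show "\<exists>f\<in>lip_ext z. c < f \<xi> - f \<eta>" if "\<xi> \<in> M_R z" "\<eta> \<in> M_R z" "c < dist_R z \<xi> \<eta>" for \<xi> \<eta> c
      using dist_R_approx[OF that] unfolding lip_ext_def by fastforce
    show "compact_space (subtopology beta_offdiag K)"
      by (rule compact_space_subtopology[OF closedin_compact_space[OF compact_beta_offdiag K(1)]])
    show "gap \<zeta> = dist_R z (proj1 \<zeta>) (proj2 \<zeta>)" if "\<zeta> \<in> K" for \<zeta>
    proof -
      have "\<zeta> \<in> R_plus z" "\<zeta> \<in> optimal_points z" using that K(2) S by blast+
      then show ?thesis using optimal_iff_gap[of \<zeta> z] by simp
    qed
    show "cyclically_monotonic (dist_R z) ((\<lambda>\<zeta>. (proj1 \<zeta>, proj2 \<zeta>)) ` K)"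
      by (rule cyclically_monotonic_subset[OF cyc]) (use K(2) in \<open>auto simp: proj_def\<close>)
    show "continuous_map (subtopology beta_offdiag K) euclideanreal (\<lambda>\<zeta>. f (proj1 \<zeta>))"
      "continuous_map (subtopology beta_offdiag K) euclideanreal (\<lambda>\<zeta>. f (proj2 \<zeta>))"
      if "f \<in> lip_ext z" for f
      using continuous_map_lip_ext_proj[OF that] continuous_map_proj1 continuous_map_proj2 PK by blast+
    show "\<exists>C. closedin beta_offdiag C \<and> C \<subseteq> A \<and> measure \<mu> (A - C) < e" if "A \<in> sets \<mu>" "0 < e" for A e
      by (rule radon_posD(4)[OF \<mu> that])
  qed (fact lip_ext_max lip_ext_min lip_ext_add_const dist_R_commute dist_R_le_radius PK
      continuous_map_gap[OF KR] K(1) radon_posD(1,2)[OF \<mu>] refl)+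
qed

text \<open>One Lipschitz function has transform at least \<open>1 - e\<close> on \<open>B\<close>
  and at least \<open>-1\<close> elsewhere. The complement of \<open>B\<close> has measure below
  \<open>2 * e\<close>, so the loss is at most \<open>e\<close> times the mass plus twice
  \<open>2 * e\<close>.\<close>

lemma dual_norm_lower_if_cyclically_monotonic:
  assumes \<mu>: "\<mu> \<in> radon_pos beta_offdiag" and S: "S \<subseteq> R_plus z \<inter> optimal_points z"
    and conc: "concentrated_on \<mu> S" and cyc: "cyclically_monotonic (dist_R z) (proj ` S)"
    and e: "0 < e"
  shows "measure \<mu> (space \<mu>) - (measure \<mu> (space \<mu>) + 4) * e \<le> dual_norm z (de_leeuw_adj \<mu>)"
proof -
  interpret finite_measure \<mu> by (rule radon_posD[OF \<mu>])
  let ?m = "measure \<mu> (space \<mu>)"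
  obtain A where A: "A \<in> sets \<mu>" "A \<subseteq> S" "measure \<mu> (space \<mu> - A) = 0"
    using concentrated_on_inner[OF conc] by blast
  obtain K where K: "closedin beta_offdiag K" "K \<subseteq> A" "measure \<mu> (A - K) < e"
    using radon_posD(4)[OF \<mu> A(1) e] by blast
  have KR: "K \<subseteq> R_plus z" using K A S by blast
  have top: "topspace (subtopology beta_offdiag K) = K"
    using closedin_subset[OF K(1)] by auto
  obtain r where r: "0 < r" "\<And>\<zeta>. \<zeta> \<in> K \<Longrightarrow> r \<le> gap \<zeta>"
    using compact_gap_lower_bound[OF KR K(1)] by blast
  interpret monotonic_contact_measure "lip_ext z" "M_R z" "\<lambda>\<xi>. delta_R \<xi> (\<lambda>x. dist x z)" "dist_R z"
    "subtopology beta_offdiag K" proj1 proj2 gap beta_offdiag \<mu>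
    using K A by (intro monotonic_contact_measure_proj[OF \<mu> S cyc]) auto
  obtain g B where g: "g \<in> lip_ext z" and B: "B \<in> sets \<mu>" "B \<subseteq> K" "measure \<mu> (K - B) < e"
    \<comment> \<open>The error \<open>e * r\<close> is at most \<open>e * gap \<zeta>\<close> on
      \<open>K\<close>, so dividing by the gap leaves at most \<open>e\<close>.\<close>
    and gB: "\<And>\<zeta>. \<zeta> \<in> B \<Longrightarrow> gap \<zeta> - e * r \<le> g (proj1 \<zeta>) - g (proj2 \<zeta>)"
    using attains_D_in_measure[of "e * r" e] e r(1) unfolding top by (meson mult_pos_pos)
  obtain f0 where f0: "1-lipschitz_on UNIV f0" "\<And>\<xi>. \<xi> \<in> M_R z \<Longrightarrow> g \<xi> = delta_R \<xi> f0"
    using g unfolding lip_ext_def by blast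
  define f where "f = (\<lambda>x. f0 x + - f0 z)"
  have f: "f z = 0" "1-lipschitz_on UNIV f"
    unfolding f_def using lipschitz_add_const[OF f0(1), of "- f0 z"] by auto
  have "slope f = slope f0" by (simp add: slope_def f_def fun_eq_iff)
  then have f_f0: "de_leeuw f \<zeta> = de_leeuw f0 \<zeta>" if "\<zeta> \<in> topspace beta_offdiag" for \<zeta>
    using that by (simp add: de_leeuw_eq[OF f(2)] de_leeuw_eq[OF f0(1)])
  have on_B: "1 - e \<le> de_leeuw f \<zeta>" if \<zeta>: "\<zeta> \<in> B" for \<zeta>
  proof -
    have R: "\<zeta> \<in> R_plus z" and "\<zeta> \<in> K" using \<zeta> B(2) KR by auto
    have "gap \<zeta> - e * r \<le> de_leeuw f \<zeta> * gap \<zeta>"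
      using gB[OF \<zeta>] f0(2) R_plusD[OF R] de_leeuw_gap[OF R f0(1)] f_f0 by simp
    moreover have "e * r \<le> e * gap \<zeta>" using r(2)[OF \<open>\<zeta> \<in> K\<close>] e by simp
    ultimately have "(1 - e) * gap \<zeta> \<le> de_leeuw f \<zeta> * gap \<zeta>" by (simp add: algebra_simps)
    then show ?thesis using gap_pos[OF R] by simp
  qed
  have Ksets: "K \<in> sets \<mu>" using topspace_T_sets unfolding top .
  have "measure \<mu> (space \<mu> - B) \<le> measure \<mu> ((space \<mu> - A) \<union> ((A - K) \<union> (K - B)))"
    using A(1) B(1) Ksets by (intro finite_measure_mono) auto
  also have "\<dots> \<le> measure \<mu> (space \<mu> - A) + measure \<mu> ((A - K) \<union> (K - B))"
    using A(1) B(1) Ksets by (intro measure_Un_le) auto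
  also have "\<dots> \<le> measure \<mu> (space \<mu> - A) + (measure \<mu> (A - K) + measure \<mu> (K - B))"
    using A(1) B(1) Ksets by (intro add_left_mono measure_Un_le) auto
  also have "\<dots> < 2 * e" using A(3) K(3) B(3) by simp
  finally have small: "measure \<mu> (space \<mu> - B) < 2 * e" .
  have ind: "integrable \<mu> (indicator (space \<mu> - B) :: _ \<Rightarrow> real)"
    using B(1) emeasure_finite[of "space \<mu> - B"]
    by (intro integrable_real_indicator) (auto simp: less_top[symmetric])
  have "?m - (?m + 4) * e \<le> ?m - e * ?m - 2 * measure \<mu> (space \<mu> - B)"
    using small by (simp add: algebra_simps)
  \<comment> \<open>The factor 2 lowers the bound from \<open>1 - e\<close> to
    \<open>- 1 - e\<close> off \<open>B\<close>, below every value of the transform.\<close>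
  also have "\<dots> = (\<integral>\<zeta>. (1 - e) - 2 * indicator (space \<mu> - B) \<zeta> \<partial>\<mu>)"
  proof (subst Bochner_Integration.integral_diff)
    show "integrable \<mu> (\<lambda>\<zeta>. 2 * indicator (space \<mu> - B) \<zeta> :: real)" using ind by simp
    have "?m - e * ?m = (\<integral>\<zeta>. 1 - e \<partial>\<mu>)" by (simp add: left_diff_distrib mult.commute)
    moreover have "(\<integral>\<zeta>. 2 * indicator (space \<mu> - B) \<zeta> \<partial>\<mu>) = 2 * measure \<mu> (space \<mu> - B)"
      using B(1) by simp
    ultimately show "?m - e * ?m - 2 * measure \<mu> (space \<mu> - B)
        = (\<integral>\<zeta>. 1 - e \<partial>\<mu>) - (\<integral>\<zeta>. 2 * indicator (space \<mu> - B) \<zeta> \<partial>\<mu>)" by simp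
  qed simp
  also have "\<dots> \<le> de_leeuw_adj \<mu> f"
    unfolding de_leeuw_adj_def
  proof (rule integral_mono)
    show "integrable \<mu> (\<lambda>\<zeta>. (1 - e) - 2 * indicator (space \<mu> - B) \<zeta>)" using ind by simp
    show "integrable \<mu> (de_leeuw f)" by (rule integrable_de_leeuw[OF \<mu> f(2)])
    show "(1 - e) - 2 * indicator (space \<mu> - B) \<zeta> \<le> de_leeuw f \<zeta>" if "\<zeta> \<in> space \<mu>" for \<zeta>
    proof (cases "\<zeta> \<in> B")
      case False
      then show ?thesis
        using that e abs_de_leeuw_le[OF f(2), of \<zeta>] by (simp add: radon_posD(3)[OF \<mu>] abs_le_iff)
    qed (use on_B in simp)
  qed
  also have "\<dots> \<le> dual_norm z (de_leeuw_adj \<mu>)"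
    using dual_norm_upper[of z "de_leeuw_adj \<mu>", OF abs_de_leeuw_adj_le[OF \<mu>] f] by simp
  finally show ?thesis .
qed

theorem theorem4p15:
  fixes z :: "'a::complete_space"
    and \<mu> :: "'a dl_point measure"
  assumes "\<mu> \<in> radon_pos beta_offdiag"
    and "concentrated_on \<mu> (R_plus z)"
  shows "\<mu> \<in> M_op z \<longleftrightarrow>
    (\<exists>C. C \<subseteq> R_plus z \<inter> optimal_points z \<and> concentrated_on \<mu> C \<and>
         cyclically_monotonic (dist_R z) (proj ` C))"
proof
  assume "\<mu> \<in> M_op z"
  then obtain f where f: "\<And>n. 1-lipschitz_on UNIV (f n)"
    and ae: "AE \<zeta> in \<mu>. (\<lambda>n. de_leeuw (f n) \<zeta>) \<longlonglongrightarrow> 1"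
    using maximising_sequence[OF assms(1)] by blast
  obtain N where N: "N \<in> null_sets \<mu>"
    and lim: "\<And>\<zeta>. \<zeta> \<in> space \<mu> - N \<Longrightarrow> (\<lambda>n. de_leeuw (f n) \<zeta>) \<longlonglongrightarrow> 1"
    using AE_E3[OF ae] by blast
  \<comment> \<open>Off the null set the maximising sequence converges at every point, so optimality
    and cyclic monotonicity hold without further exceptions.\<close>
  let ?C = "R_plus z - N"
  have C: "(\<lambda>n. de_leeuw (f n) \<zeta>) \<longlonglongrightarrow> 1" if "\<zeta> \<in> ?C" for \<zeta>
    using that R_plusD(1) by (intro lim) (auto simp: radon_posD(3)[OF assms(1)])
  have "?C \<subseteq> optimal_points z"
  proof
    fix \<zeta> assume \<zeta>: "\<zeta> \<in> ?C"
    then have "\<zeta> \<in> R_plus z" by blast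
    then show "\<zeta> \<in> optimal_points z"
      using optimal_iff_gap[of \<zeta> z] maximising_gap(1)[of \<zeta> z f, OF _ f C[OF \<zeta>]] by blast
  qed
  moreover have "concentrated_on \<mu> ?C" by (rule concentrated_on_Diff_null[OF assms(2) N])
  moreover have "cyclically_monotonic (dist_R z) (proj ` ?C)"
    by (rule cyclically_monotonic_maximising[of ?C z f, OF _ f C]) auto
  ultimately show "\<exists>C. C \<subseteq> R_plus z \<inter> optimal_points z \<and> concentrated_on \<mu> C \<and>
      cyclically_monotonic (dist_R z) (proj ` C)" by (intro exI[of _ ?C]) auto
next
  assume "\<exists>C. C \<subseteq> R_plus z \<inter> optimal_points z \<and> concentrated_on \<mu> C \<and>
      cyclically_monotonic (dist_R z) (proj ` C)"
  then obtain C where C: "C \<subseteq> R_plus z \<inter> optimal_points z" "concentrated_on \<mu> C"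
    "cyclically_monotonic (dist_R z) (proj ` C)" by blast
  let ?m = "measure \<mu> (space \<mu>)"
  have m: "0 < ?m + 4" by (simp add: add_nonneg_pos)
  have "?m \<le> dual_norm z (de_leeuw_adj \<mu>) + e" if "0 < e" for e
  proof -
    \<comment> \<open>Dividing by \<open>?m + 4\<close> scales the total error to
      \<open>e\<close>.\<close>
    have "?m - (?m + 4) * (e / (?m + 4)) \<le> dual_norm z (de_leeuw_adj \<mu>)"
      using m that by (intro dual_norm_lower_if_cyclically_monotonic[OF assms(1) C]) simp
    then show ?thesis using m by simp
  qed
  then have "?m \<le> dual_norm z (de_leeuw_adj \<mu>)" by (rule field_le_epsilon)
  then show "\<mu> \<in> M_op z" using M_op_iff[OF assms(1)] by blast
qed

end
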